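(* Let $J\in\mathcal C(\mathbb R^n,\mathbb R)$ be nonnegative, spherically symmetric and radially decreasing, with $J(0)>0$ and $\int_{\mathbb R^n}J(x)\,dx=1$. Let $\Omega\subset\mathbb R^n$ be an open bounded set, $a_\Omega:\overline\Omega\to\mathbb R^+$ a non-negative continuous function, and $\Omega^*$ an open ball (centered at the origin) with the same measure as $\Omega$. Let ${a_*}_{\Omega^*}:\Omega^*\to\mathbb R^+$ be the symmetric increasing rearrangement of $a_\Omega$, and define the self-adjoint operators $$\mathcal B_\Omega u(x)=a_\Omega(x)u(x)-\int_\Omega J(x-y)u(y)\,dy,\quad x\in\Omega,\ u\in L^2(\Omega),$$ $$\mathcal B^*_{\Omega^*}u(x)={a_*}_{\Omega^*}(x)u(x)-\int_{\Omega^*}J(x-y)u(y)\,dy,\quad x\in\Omega^*,\ u\in L^2(\Omega^* ).$$ Assume that the first eigenvalues of $\mathcal B_\Omega$ and $\mathcal B^*_{\Omega^*}$ exist, and denote them by $\lambda_1(\Omega)$ and $\lambda_1^*(\Omega^* )$ respectively. Then $$\lambda_1(\Omega)\ge\lambda_1^*(\Omega^* ).$$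
   Context: The first (principal) eigenvalue of such a bounded self-adjoint operator is the minimum of its spectrum, when this minimum is a simple, isolated eigenvalue associated with a continuous and strictly positive eigenfunction. Rearrangements. For a measurable $u:\Omega\to\mathbb R$ with $|\Omega|<\infty$, its distribution function is $\mu(t)=|\{x\in\Omega:|u(x)|>t\}|$, $t\ge0$. The decreasing rearrangement $u^{\#}:\mathbb R^+\to\mathbb R^+$ is the distribution function of $\mu$, i.e. $u^{\#}(s)=|\{t\ge0:\mu(t)>s\}|$. The increasing rearrangement is $u_{\#}(s)=u^{\#}(|\Omega|-s)$, and the symmetric increasing rearrangement is $u_*:\Omega^*\to\mathbb R^+$, $u_*(x)=u_{\#}(c_n|x|^n)$, where $c_n=\pi^{n/2}/\Gamma(n/2+1)$ is the volume of the unit ball of $\mathbb R^n$ and $|\cdot|$ applied to a set is Lebesgue measure. Thus ${a_*}_{\Omega^*}=(a_\Omega)_*$. *)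

theory Defs
  imports "HOL-Analysis.Analysis"
begin

text \<open>
  Elements of the real Hilbert space \<open>L\<^sup>2(S)\<close> are represented by functions that are
  measurable on \<open>S\<close>; equality in \<open>L\<^sup>2(S)\<close> is equality almost everywhere on \<open>S\<close>, and
  values outside \<open>S\<close> are irrelevant.
\<close>

definition L2_space :: "'a::euclidean_space set \<Rightarrow> ('a \<Rightarrow> real) set" where
  "L2_space S = {u. u \<in> borel_measurable (lebesgue_on S) \<and>
                    integrable (lebesgue_on S) (\<lambda>x. (u x)\<^sup>2)}"

definition L2_norm :: "'a::euclidean_space set \<Rightarrow> ('a \<Rightarrow> real) \<Rightarrow> real" where
  "L2_norm S u = sqrt (LINT x|lebesgue_on S. (u x)\<^sup>2)"

definition L2_eq :: "'a::euclidean_space set \<Rightarrow> ('a \<Rightarrow> real) \<Rightarrow> ('a \<Rightarrow> real) \<Rightarrow> bool" where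
  "L2_eq S u v \<longleftrightarrow> (AE x in lebesgue_on S. u x = v x)"

text \<open>
  An operator on \<open>L\<^sup>2(S)\<close> is given by a map \<open>T\<close> on representatives; it is meant to be linear,
  bounded and compatible with equality almost everywhere. The number \<open>\<mu>\<close> is in the resolvent
  set when \<open>T - \<mu>\<close> is a bijection of \<open>L\<^sup>2(S)\<close> with bounded inverse: every \<open>f\<close> has exactly one
  preimage \<open>u\<close>, and \<open>C\<close> bounds the norm of the inverse. Only real \<open>\<mu>\<close> are considered; for
  self-adjoint operators this is the whole spectrum.
\<close>

definition resolvent_set ::
  "'a::euclidean_space set \<Rightarrow> (('a \<Rightarrow> real) \<Rightarrow> 'a \<Rightarrow> real) \<Rightarrow> real set" where
  "resolvent_set S T =
     {\<mu>. \<exists>C. \<forall>f\<in>L2_space S. \<exists>u\<in>L2_space S.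
            L2_eq S (\<lambda>x. T u x - \<mu> * u x) f \<and>
            (\<forall>v\<in>L2_space S. L2_eq S (\<lambda>x. T v x - \<mu> * v x) f \<longrightarrow> L2_eq S v u) \<and>
            L2_norm S u \<le> C * L2_norm S f}"

definition spectrum ::
  "'a::euclidean_space set \<Rightarrow> (('a \<Rightarrow> real) \<Rightarrow> 'a \<Rightarrow> real) \<Rightarrow> real set" where
  "spectrum S T = - resolvent_set S T"

definition eigenfunction ::
  "'a::euclidean_space set \<Rightarrow> (('a \<Rightarrow> real) \<Rightarrow> 'a \<Rightarrow> real) \<Rightarrow> real \<Rightarrow> ('a \<Rightarrow> real) \<Rightarrow> bool" where
  "eigenfunction S T \<mu> u \<longleftrightarrow>
     u \<in> L2_space S \<and> \<not> L2_eq S u (\<lambda>x. 0) \<and> L2_eq S (T u) (\<lambda>x. \<mu> * u x)"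

text \<open>Simplicity means that the eigenspace is one-dimensional.\<close>

definition simple_eigenvalue ::
  "'a::euclidean_space set \<Rightarrow> (('a \<Rightarrow> real) \<Rightarrow> 'a \<Rightarrow> real) \<Rightarrow> real \<Rightarrow> bool" where
  "simple_eigenvalue S T \<mu> \<longleftrightarrow>
     (\<exists>u. eigenfunction S T \<mu> u \<and>
          (\<forall>v. eigenfunction S T \<mu> v \<longrightarrow> (\<exists>c. L2_eq S v (\<lambda>x. c * u x))))"

definition first_eigenvalue ::
  "'a::euclidean_space set \<Rightarrow> (('a \<Rightarrow> real) \<Rightarrow> 'a \<Rightarrow> real) \<Rightarrow> real \<Rightarrow> bool" where
  "first_eigenvalue S T \<mu> \<longleftrightarrow>
     \<mu> \<in> spectrum S T \<and> (\<forall>\<nu>\<in>spectrum S T. \<mu> \<le> \<nu>) \<and>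
     simple_eigenvalue S T \<mu> \<and>
     \<mu> isolated_in spectrum S T \<and>
     (\<exists>\<phi>. eigenfunction S T \<mu> \<phi> \<and> continuous_on S \<phi> \<and> (\<forall>x\<in>S. 0 < \<phi> x))"

text \<open>
  Measures are real-valued, so these definitions are meant for \<open>u\<close> bounded and \<open>S\<close> of finite
  measure (the function \<open>measure\<close> is \<open>0\<close> on sets of infinite measure).
\<close>

definition distribution_fun :: "'a::euclidean_space set \<Rightarrow> ('a \<Rightarrow> real) \<Rightarrow> real \<Rightarrow> real" where
  "distribution_fun S u t = measure lebesgue {x\<in>S. \<bar>u x\<bar> > t}"

definition decreasing_rearrangement ::
  "'a::euclidean_space set \<Rightarrow> ('a \<Rightarrow> real) \<Rightarrow> real \<Rightarrow> real" where
  "decreasing_rearrangement S u s = measure lebesgue {t. 0 \<le> t \<and> distribution_fun S u t > s}"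

definition increasing_rearrangement ::
  "'a::euclidean_space set \<Rightarrow> ('a \<Rightarrow> real) \<Rightarrow> real \<Rightarrow> real" where
  "increasing_rearrangement S u s = decreasing_rearrangement S u (measure lebesgue S - s)"

text \<open>Only the values on the centered ball of the same measure as \<open>S\<close> are meaningful.\<close>

definition symmetric_increasing_rearrangement ::
  "'a::euclidean_space set \<Rightarrow> ('a \<Rightarrow> real) \<Rightarrow> 'a \<Rightarrow> real" where
  "symmetric_increasing_rearrangement S u x =
     increasing_rearrangement S u (unit_ball_vol (real DIM('a)) * norm x ^ DIM('a))"

definition nonlocal_operator ::
  "('a::euclidean_space \<Rightarrow> real) \<Rightarrow> 'a set \<Rightarrow> ('a \<Rightarrow> real) \<Rightarrow> ('a \<Rightarrow> real) \<Rightarrow> 'a \<Rightarrow> real" where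
  "nonlocal_operator J S a u x = a x * u x - (LINT y|lebesgue_on S. J (x - y) * u y)"

end

theory Submission
  imports Defs
begin

text \<open>
  Let \<open>\<phi>\<close> be the positive eigenfunction on \<open>\<Omega>\<close> and \<open>\<psi>\<close> its symmetric decreasing rearrangement.
  Since \<open>\<lambda>\<^sub>1\<^sup>*\<close> bounds the spectrum of \<open>\<B>\<^sup>*\<close> from below, it bounds the Rayleigh quotient of \<open>\<psi>\<close>;
  and \<open>\<parallel>\<psi>\<parallel> = \<parallel>\<phi>\<parallel>\<close>, \<open>\<integral> a\<^sub>* \<psi>\<^sup>2 \<le> \<integral> a \<phi>\<^sup>2\<close> (Hardy--Littlewood) and
  \<open>\<integral>\<integral> \<phi>(x) J(x - y) \<phi>(y) \<le> \<integral>\<integral> \<psi>(x) J(x - y) \<psi>(y)\<close> (Riesz).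
  By the layer cake formula Riesz' inequality reduces to superlevel sets \<open>A\<close>, \<open>B\<close>. Polarization
  with respect to a hyperplane does not decrease \<open>\<integral>\<integral> 1\<^sub>A(x) J(x - y) 1\<^sub>B(y)\<close>, and it decreases the
  deficit \<open>\<bar>A - A\<^sup>*\<bar>\<close> by the measure of the points of \<open>A\<^sup>* - A\<close> reflected into \<open>A - A\<^sup>*\<close>.
  Averaging over all hyperplanes, some reflection gains an amount depending only on the deficit
  and on a bounding radius, so no compactness is needed: the infimum of the deficit over all
  competitors with at least the same energy is zero.
\<close>

text \<open>Small deficits settle the matter because the kernel is bounded: \<open>J\<close> is at
  most \<open>J 0\<close>, so the energy of two sets exceeds that of the balls by at most
  \<open>J 0\<close> times the deficits times fixed volumes. Hence no limit of the polarized sets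
  has to be formed. Both sets are polarized with the same hyperplane, as the kernel inequality
  demands; since neither deficit can increase, a gain for one of the sets already lowers the sum.
  Each set has the volume of its ball, so the part of the ball it misses is as large as its excess,
  and averaging can look for a hyperplane that carries much of the former into the latter.

  The rearranged function is only a trial function in L^2 and in general no eigenfunction of the
  second operator. That its Rayleigh quotient is bounded by the bottom of the spectrum is therefore
  derived directly from the bounded inverse in the definition of the resolvent set.\<close>

subsection \<open>Reflections and polarization\<close>

text \<open>
  For \<open>w \<noteq> 0\<close> this is the reflection that exchanges \<open>0\<close> and \<open>w\<close>, and \<open>halfspace w\<close> is the side of
  its hyperplane containing \<open>0\<close>. The junk value \<open>reflection 0\<close> is the identity.
\<close>
definition reflection :: "'a::euclidean_space \<Rightarrow> 'a \<Rightarrow> 'a" where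
  "reflection w z = z + (1 - 2 * (z \<bullet> w) / (w \<bullet> w)) *\<^sub>R w"

definition halfspace :: "'a::euclidean_space \<Rightarrow> 'a set" where
  "halfspace w = {z. 2 * (z \<bullet> w) \<le> w \<bullet> w}"

text \<open>The two-point rearrangement: in a mirror pair that meets \<open>A\<close> in exactly one
  point, that point is placed on the side of the origin; all other pairs stay as they are.\<close>

definition polarization :: "'a::euclidean_space \<Rightarrow> 'a set \<Rightarrow> 'a set" where
  "polarization w A = (halfspace w \<inter> (A \<union> reflection w -` A)) \<union> (A \<inter> reflection w -` A)"

lemma reflection_inner: "w \<noteq> 0 \<Longrightarrow> reflection w z \<bullet> w = w \<bullet> w - z \<bullet> w"
  by (simp add: reflection_def inner_add_left field_simps)

lemma reflection_reflection: "w \<noteq> 0 \<Longrightarrow> reflection w (reflection w z) = z"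
  unfolding reflection_def [of w "reflection w z"] reflection_inner
  by (simp add: reflection_def field_simps flip: scaleR_add_left)

lemma reflection_in_halfspace: "w \<noteq> 0 \<Longrightarrow> reflection w z \<in> halfspace w \<longleftrightarrow> w \<bullet> w \<le> 2 * (z \<bullet> w)"
  by (auto simp: halfspace_def reflection_inner)

text \<open>With d the signed distance to the mirror, the correction is 4 d(x) d(y). The norm
  comparisons for polarization are thus sign questions for this product; x = 0 compares a point with
  its own mirror image, as 0 lies in \<open>halfspace w\<close>.\<close>

lemma norm_diff_reflection_sq:
  assumes "w \<noteq> 0"
  shows "(norm (x - reflection w y))\<^sup>2 = (norm (x - y))\<^sup>2 +
           (w \<bullet> w - 2 * (x \<bullet> w)) * (w \<bullet> w - 2 * (y \<bullet> w)) / (w \<bullet> w)"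
proof -
  define c where "c = 1 - 2 * (y \<bullet> w) / (w \<bullet> w)"
  have ww: "w \<bullet> w \<noteq> 0" using assms by simp
  have c: "c * (w \<bullet> w) = w \<bullet> w - 2 * (y \<bullet> w)"
    using ww by (simp add: c_def field_simps)
  have "(norm (x - reflection w y))\<^sup>2 = (norm (x - y - c *\<^sub>R w))\<^sup>2"
    by (simp add: reflection_def c_def diff_diff_eq)
  also have "\<dots> = (norm (x - y))\<^sup>2 - 2 * c * ((x - y) \<bullet> w) + c * (c * (w \<bullet> w))"
    by (simp add: power2_norm_eq_inner inner_diff_left inner_diff_right inner_commute algebra_simps)
  also have "\<dots> = (norm (x - y))\<^sup>2 + c * (w \<bullet> w - 2 * (x \<bullet> w))"
    unfolding c by (simp add: inner_diff_left algebra_simps)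
  also have "c = (w \<bullet> w - 2 * (y \<bullet> w)) / (w \<bullet> w)"
    using c ww by (simp add: field_simps)
  finally show ?thesis by simp
qed

lemma norm_reflection_sq: "w \<noteq> 0 \<Longrightarrow> (norm (reflection w y))\<^sup>2 = (norm y)\<^sup>2 + (w \<bullet> w - 2 * (y \<bullet> w))"
  using norm_diff_reflection_sq [of w 0 y] by simp

lemma norm_reflection_diff_reflection: "w \<noteq> 0 \<Longrightarrow> norm (reflection w x - reflection w y) = norm (x - y)"
  using norm_diff_reflection_sq [of w "reflection w x" y] norm_diff_reflection_sq [of w y x]
  by (simp add: reflection_inner algebra_simps norm_minus_commute flip: add_divide_distrib diff_divide_distrib)

lemma norm_reflection_diff: "w \<noteq> 0 \<Longrightarrow> norm (reflection w x - y) = norm (x - reflection w y)"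
  by (metis norm_reflection_diff_reflection reflection_reflection)

lemma norm_diff_le_norm_diff_reflection:
  assumes "w \<noteq> 0" "x \<in> halfspace w \<longleftrightarrow> y \<in> halfspace w"
  shows "norm (x - y) \<le> norm (x - reflection w y)"
proof (rule power2_le_imp_le)
  have "0 \<le> (w \<bullet> w - 2 * (x \<bullet> w)) * (w \<bullet> w - 2 * (y \<bullet> w)) / (w \<bullet> w)"
    using assms by (auto simp: halfspace_def zero_le_mult_iff intro!: divide_nonneg_nonneg)
  then show "(norm (x - y))\<^sup>2 \<le> (norm (x - reflection w y))\<^sup>2"
    using norm_diff_reflection_sq [OF assms(1), of x y] by simp
qed simp

lemma norm_le_norm_reflection_iff: "w \<noteq> 0 \<Longrightarrow> norm z \<le> norm (reflection w z) \<longleftrightarrow> z \<in> halfspace w"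
  using norm_reflection_sq [of w z]
  by (auto simp: halfspace_def simp flip: power_mono_iff [of _ _ 2])

lemma reflection_eq_self: "w \<noteq> 0 \<Longrightarrow> z \<in> halfspace w \<Longrightarrow> reflection w z \<in> halfspace w \<Longrightarrow> reflection w z = z"
  by (auto simp: reflection_in_halfspace) (auto simp: halfspace_def reflection_def)

lemma reflection_in_halfspace_if: "w \<noteq> 0 \<Longrightarrow> z \<notin> halfspace w \<Longrightarrow> reflection w z \<in> halfspace w"
  by (auto simp: reflection_in_halfspace) (auto simp: halfspace_def)

lemma measurable_reflection2 [measurable (raw)]:
  assumes [measurable]: "f \<in> borel_measurable M" "g \<in> borel_measurable M"
  shows "(\<lambda>x. reflection (f x) (g x)) \<in> borel_measurable M"
  unfolding reflection_def by measurable

lemma halfspace_borel [measurable]: "halfspace w \<in> sets borel"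
  unfolding halfspace_def by measurable

lemma polarization_borel [measurable (raw)]: "A \<in> sets borel \<Longrightarrow> polarization w A \<in> sets borel"
proof -
  assume [measurable]: "A \<in> sets borel"
  have "reflection w -` A \<in> sets borel"
    using measurable_sets_borel [OF _ \<open>A \<in> sets borel\<close>, of "reflection w"] by simp
  then show ?thesis unfolding polarization_def by auto
qed

text \<open>Keeps all competitors of the later minimization in one fixed ball, so that one gain
  constant serves them all.\<close>

lemma polarization_subset_cball:
  assumes "w \<noteq> 0" "A \<subseteq> cball 0 R"
  shows "polarization w A \<subseteq> cball 0 R"
  using assms norm_le_norm_reflection_iff [OF assms(1)]
  by (auto simp: polarization_def subset_eq) (metis order_trans)

section \<open>Invariance of Lebesgue measure under reflections\<close>

text \<open>
  The uniqueness argument for Haar measure: for translation invariant measures \<open>\<mu>\<close>, \<open>\<nu>\<close>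
  the identity \<open>\<mu> A * \<nu> B = \<mu> B * \<nu> (- A)\<close> follows from Fubini's theorem; here \<open>\<nu>\<close> is the
  image of \<open>\<mu>\<close> and \<open>A\<close> is the unit ball.
\<close>
lemma distr_lborel_linear_isometry:
  fixes R :: "'a::euclidean_space \<Rightarrow> 'a"
  assumes lin: "linear R" and iso: "\<And>z. norm (R z) = norm z"
  shows "distr lborel borel R = lborel"
proof (rule measure_eqI)
  have [measurable]: "R \<in> borel_measurable borel"
    using lin by (intro borel_measurable_continuous_onI linear_continuous_on linear_conv_bounded_linear [THEN iffD1])
  have inj: "inj R"
    using iso by (intro linear_injective_0 [OF lin, THEN iffD2]) (metis norm_eq_zero)
  then have bij: "bij R"
    using linear_injective_imp_surjective [OF lin] by (auto simp: bij_def)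
  have transl: "(\<integral>\<^sup>+x. f (x + c) \<partial>lborel) = (\<integral>\<^sup>+x. f x \<partial>lborel)"
    if [measurable]: "f \<in> borel_measurable borel" for f and c :: 'a
    using nn_integral_distr [of "(+) c" lborel borel f] lborel_distr_plus [of c]
    by (simp add: add.commute)
  \<comment> \<open>Since \<open>R\<close> is linear and onto,
    \<open>R x + c = R (x + inv R c)\<close>: integrals against the image measure are translation
    invariant too.\<close>
  have transl_R: "(\<integral>\<^sup>+x. f (R x + c) \<partial>lborel) = (\<integral>\<^sup>+x. f (R x) \<partial>lborel)"
    if [measurable]: "f \<in> borel_measurable borel" for f c
    using transl [of "\<lambda>x. f (R x)" "inv R c"] bij
    by (simp add: linear_add [OF lin] bij_is_surj surj_f_inv_f)
  fix B assume "B \<in> sets (distr lborel borel R)"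
  then have [measurable]: "B \<in> sets borel" by simp
  \<comment> \<open>The unit ball fixes the constant of proportionality as 1: it is invariant under
    \<open>R\<close>, and its finite positive volume can be cancelled at the end.\<close>
  define A where "A = ball (0 :: 'a) 1"
  have [measurable]: "A \<in> sets borel" by (simp add: A_def)
  have A_R: "indicator A (R x) = (indicator A x :: ennreal)" for x
    by (simp add: A_def indicator_def iso)
  have A_minus: "indicator A (- x) = (indicator A x :: ennreal)" for x
    by (simp add: A_def indicator_def)
  have "emeasure (distr lborel borel R) B = (\<integral>\<^sup>+y. indicator B (R y) \<partial>lborel)"
    using nn_integral_distr [of R lborel borel "indicator B"] by simp
  then have "emeasure lborel A * emeasure (distr lborel borel R) B =
        (\<integral>\<^sup>+x. indicator A x * (\<integral>\<^sup>+y. indicator B (R y + x) \<partial>lborel) \<partial>lborel)"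
    unfolding transl_R [of "indicator B", simplified]
    by (subst nn_integral_multc) simp_all
  also have "\<dots> = (\<integral>\<^sup>+x. \<integral>\<^sup>+y. indicator A x * indicator B (R y + x) \<partial>lborel \<partial>lborel)"
    by (simp add: nn_integral_cmult)
  also have "\<dots> = (\<integral>\<^sup>+y. \<integral>\<^sup>+x. indicator A x * indicator B (R y + x) \<partial>lborel \<partial>lborel)"
    by (rule lborel_pair.Fubini') simp
  also have "\<dots> = (\<integral>\<^sup>+y. \<integral>\<^sup>+x. indicator A (R y - x) * indicator B x \<partial>lborel \<partial>lborel)"
  proof (rule nn_integral_cong)
    fix y
    show "(\<integral>\<^sup>+x. indicator A x * indicator B (R y + x) \<partial>lborel) =
          (\<integral>\<^sup>+x. indicator A (R y - x) * indicator B x \<partial>lborel)"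
      using transl [of "\<lambda>x. indicator A (R y - x) * indicator B x" "R y"]
      by (simp add: add.commute A_minus)
  qed
  also have "\<dots> = (\<integral>\<^sup>+x. \<integral>\<^sup>+y. indicator A (R y - x) * indicator B x \<partial>lborel \<partial>lborel)"
    by (rule lborel_pair.Fubini') simp
  also have "\<dots> = (\<integral>\<^sup>+x. (\<integral>\<^sup>+y. indicator A (R y - x) \<partial>lborel) * indicator B x \<partial>lborel)"
    by (simp add: nn_integral_multc)
  also have "\<dots> = (\<integral>\<^sup>+x. emeasure lborel A * indicator B x \<partial>lborel)"
    using transl_R [of "indicator A" "- x" for x] by (simp add: A_R)
  also have "\<dots> = emeasure lborel A * emeasure lborel B"
    by (simp add: nn_integral_cmult)
  finally show "emeasure (distr lborel borel R) B = emeasure lborel B"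
    using unit_ball_vol_pos [of "real DIM('a)", THEN less_imp_neq]
    by (subst (asm) ennreal_mult_cancel_left) (auto simp: A_def emeasure_ball)
qed simp

lemma distr_lborel_reflection:
  assumes "w \<noteq> 0"
  shows "distr lborel borel (reflection w) = lborel"
proof -
  \<comment> \<open>The linear part, namely the reflection in the parallel hyperplane through the
    origin; the translation by \<open>w\<close> is split off.\<close>
  define R where "R z = z - (2 * (z \<bullet> w) / (w \<bullet> w)) *\<^sub>R w" for z
  have reflection: "reflection w = (+) w \<circ> R"
    by (simp add: fun_eq_iff reflection_def R_def algebra_simps)
  have lin: "linear R"
    unfolding R_def by (intro linearI) (auto simp: inner_add_left algebra_simps add_divide_distrib)
  have iso: "norm (R z) = norm z" for z
    using norm_reflection_diff_reflection [OF assms, of z 0] by (simp add: reflection R_def)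
  have [measurable]: "R \<in> borel_measurable borel"
    unfolding R_def by measurable
  have "distr lborel borel (reflection w) = distr (distr lborel borel R) borel ((+) w)"
    unfolding reflection by (subst distr_distr) auto
  then show ?thesis
    by (simp add: distr_lborel_linear_isometry [OF lin iso] lborel_distr_plus)
qed

lemma nn_integral_reflection:
  assumes "w \<noteq> 0" and [measurable]: "f \<in> borel_measurable borel"
  shows "(\<integral>\<^sup>+x. f (reflection w x) \<partial>lborel) = (\<integral>\<^sup>+x. f x \<partial>lborel)"
  using nn_integral_distr [of "reflection w" lborel borel f] distr_lborel_reflection [OF assms(1)] by simp

text \<open>Twice the integral of f is the integral of f plus its mirror image, so only sums over
  mirror pairs need to be compared, and every pair has a point on the near side. Estimates for
  polarization thereby become finite case distinctions.\<close>

lemma nn_integral_mono_reflection: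
  assumes "w \<noteq> 0" and [measurable]: "f \<in> borel_measurable borel" "g \<in> borel_measurable borel"
    and le: "\<And>x. x \<in> halfspace w \<Longrightarrow> f x + f (reflection w x) \<le> g x + g (reflection w x)"
  shows "(\<integral>\<^sup>+x. f x \<partial>lborel) \<le> (\<integral>\<^sup>+x. g x \<partial>lborel)"
proof -
  have le': "f x + f (reflection w x) \<le> g x + g (reflection w x)" for x
    using le [of x] le [of "reflection w x"] reflection_in_halfspace_if [OF assms(1), of x]
    by (cases "x \<in> halfspace w") (auto simp: reflection_reflection assms(1) add.commute)
  have "2 * (\<integral>\<^sup>+x. f x \<partial>lborel) = (\<integral>\<^sup>+x. f x + f (reflection w x) \<partial>lborel)"
    by (simp add: nn_integral_add nn_integral_reflection [OF assms(1)] mult_2)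
  also have "\<dots> \<le> (\<integral>\<^sup>+x. g x + g (reflection w x) \<partial>lborel)"
    by (intro nn_integral_mono le')
  also have "\<dots> = 2 * (\<integral>\<^sup>+x. g x \<partial>lborel)"
    by (simp add: nn_integral_add nn_integral_reflection [OF assms(1)] mult_2)
  finally show ?thesis
    by (simp add: ennreal_mult_le_mult_iff)
qed

lemma mem_polarization:
  assumes "w \<noteq> 0" "x \<in> halfspace w"
  shows "x \<in> polarization w A \<longleftrightarrow> x \<in> A \<or> reflection w x \<in> A"
    and "reflection w x \<in> polarization w A \<longleftrightarrow> x \<in> A \<and> reflection w x \<in> A"
  using assms reflection_eq_self [OF assms] by (auto simp: polarization_def reflection_reflection)

lemma emeasure_polarization:
  assumes "w \<noteq> 0" and [measurable]: "A \<in> sets borel"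
  shows "emeasure lborel (polarization w A) = emeasure lborel A"
proof -
  have [measurable]: "polarization w A \<in> sets borel" by (rule polarization_borel) fact
  have "indicator A x + indicator A (reflection w x) =
        (indicator (polarization w A) x + indicator (polarization w A) (reflection w x) :: ennreal)"
    if "x \<in> halfspace w" for x
    using mem_polarization [OF assms(1) that] by (auto simp: indicator_def)
  then have "(\<integral>\<^sup>+x. indicator (polarization w A) x \<partial>lborel) = (\<integral>\<^sup>+x. indicator A x \<partial>lborel)"
    by (intro antisym nn_integral_mono_reflection [OF assms(1)]) auto
  then show ?thesis by simp
qed

text \<open>Taken in \<open>ennreal\<close>, so that Fubini and monotonicity come without
  integrability conditions.\<close>

definition energy :: "('a::euclidean_space \<Rightarrow> real) \<Rightarrow> 'a set \<Rightarrow> 'a set \<Rightarrow> ennreal" where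
  "energy J A B = (\<integral>\<^sup>+x. \<integral>\<^sup>+y. indicator A x * indicator B y * ennreal (J (x - y)) \<partial>lborel \<partial>lborel)"

text \<open>Pairing both variables leaves two kernel values: J(x - y) for points on the same side
  and J(x - \<sigma> y), which is not larger, for points on opposite sides. The pair sum changes
  only if one set holds just the near point and the other just the far point of its pair; then the
  smaller value is replaced by the larger.\<close>

lemma energy_le_polarization:
  assumes w: "w \<noteq> 0" and [measurable]: "A \<in> sets borel" "B \<in> sets borel" "J \<in> borel_measurable borel"
    and J: "\<And>x y. norm x \<le> norm y \<Longrightarrow> J y \<le> J x"
  shows "energy J A B \<le> energy J (polarization w A) (polarization w B)"
  unfolding energy_def
proof (rule nn_integral_mono_reflection [OF w])
  let ?\<sigma> = "reflection w"
  let ?F = "\<lambda>A B x y. indicator A x * indicator B y * ennreal (J (x - y)) :: ennreal"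
  let ?A = "polarization w A" and ?B = "polarization w B"
  have [measurable]: "?\<sigma> \<in> borel_measurable borel" by measurable
  have [measurable]: "?A \<in> sets borel" "?B \<in> sets borel" by (rule polarization_borel; fact)+
  show "(\<lambda>x. \<integral>\<^sup>+y. ?F A B x y \<partial>lborel) \<in> borel_measurable borel" by measurable
  show "(\<lambda>x. \<integral>\<^sup>+y. ?F ?A ?B x y \<partial>lborel) \<in> borel_measurable borel" by measurable
  fix x assume x: "x \<in> halfspace w"
  have "(\<integral>\<^sup>+y. ?F A B x y \<partial>lborel) + (\<integral>\<^sup>+y. ?F A B (?\<sigma> x) y \<partial>lborel) =
        (\<integral>\<^sup>+y. ?F A B x y + ?F A B (?\<sigma> x) y \<partial>lborel)"
    by (simp add: nn_integral_add)
  also have "\<dots> \<le> (\<integral>\<^sup>+y. ?F ?A ?B x y + ?F ?A ?B (?\<sigma> x) y \<partial>lborel)"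
  proof (rule nn_integral_mono_reflection [OF w])
    fix y assume y: "y \<in> halfspace w"
    \<comment> \<open>\<open>J\<close> is radial: the monotonicity hypothesis applies in both
      directions to points of equal norm.\<close>
    have k: "J (?\<sigma> x - ?\<sigma> y) = J (x - y)" "J (?\<sigma> x - y) = J (x - ?\<sigma> y)"
      using norm_reflection_diff_reflection [OF w, of x y] norm_reflection_diff [OF w, of x y]
      by (intro antisym J; simp)+
    have le: "ennreal (J (x - ?\<sigma> y)) \<le> ennreal (J (x - y))"
      using x y by (intro ennreal_leI J norm_diff_le_norm_diff_reflection [OF w]) auto
    show "(?F A B x y + ?F A B (?\<sigma> x) y) + (?F A B x (?\<sigma> y) + ?F A B (?\<sigma> x) (?\<sigma> y)) \<le>
          (?F ?A ?B x y + ?F ?A ?B (?\<sigma> x) y) + (?F ?A ?B x (?\<sigma> y) + ?F ?A ?B (?\<sigma> x) (?\<sigma> y))"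
      using le
      by (cases "x \<in> A"; cases "?\<sigma> x \<in> A"; cases "y \<in> B"; cases "?\<sigma> y \<in> B")
         (auto simp: k mem_polarization [OF w x] mem_polarization [OF w y] add_ac)
  qed auto
  also have "\<dots> = (\<integral>\<^sup>+y. ?F ?A ?B x y \<partial>lborel) + (\<integral>\<^sup>+y. ?F ?A ?B (?\<sigma> x) y \<partial>lborel)"
    by (simp add: nn_integral_add)
  finally show "(\<integral>\<^sup>+y. ?F A B x y \<partial>lborel) + (\<integral>\<^sup>+y. ?F A B (?\<sigma> x) y \<partial>lborel) \<le> \<dots>" .
qed

text \<open>A centred ball that contains the far point of a mirror pair contains the near one, so no
  part of \<open>A\<close> is moved out of the ball. The second set collects the near points not in
  \<open>A\<close> whose mirror image is in \<open>A\<close> outside the ball; these are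
  gained.\<close>

lemma emeasure_polarization_Int_ball:
  assumes w: "w \<noteq> 0" and [measurable]: "A \<in> sets borel"
  shows "emeasure lborel (A \<inter> ball 0 \<rho>) + emeasure lborel {x \<in> ball 0 \<rho> - A. reflection w x \<in> A - ball 0 \<rho>}
           \<le> emeasure lborel (polarization w A \<inter> ball 0 \<rho>)"
proof -
  let ?\<sigma> = "reflection w"
  have [measurable]: "polarization w A \<in> sets borel" by (rule polarization_borel) fact
  define S :: "'a set" where "S = ball 0 \<rho>"
  have [measurable]: "S \<in> sets borel" by (simp add: S_def)
  have [measurable]: "?\<sigma> \<in> borel_measurable borel" by measurable
  define N where "N = {x \<in> S - A. ?\<sigma> x \<in> A - S}"
  have N [measurable]: "N \<in> sets borel" unfolding N_def by measurable
  have "(\<integral>\<^sup>+x. indicator (A \<inter> S) x + indicator N x \<partial>lborel) \<le> (\<integral>\<^sup>+x. indicator (polarization w A \<inter> S) x \<partial>lborel)"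
  proof (rule nn_integral_mono_reflection [OF w])
    fix x assume x: "x \<in> halfspace w"
    have "?\<sigma> x \<in> S \<Longrightarrow> x \<in> S"
      using x norm_le_norm_reflection_iff [OF w, of x] by (auto simp: S_def)
    then show "(indicator (A \<inter> S) x + indicator N x) + (indicator (A \<inter> S) (?\<sigma> x) + indicator N (?\<sigma> x))
               \<le> (indicator (polarization w A \<inter> S) x + indicator (polarization w A \<inter> S) (?\<sigma> x) :: ennreal)"
      by (auto simp: indicator_def N_def mem_polarization [OF w x] reflection_reflection w)
  qed auto
  then have "emeasure lborel (A \<inter> S) + emeasure lborel N \<le> emeasure lborel (polarization w A \<inter> S)"
    by (simp add: nn_integral_add)
  then show ?thesis
    by (simp only: S_def N_def)
qed

subsection \<open>Averaging over reflections\<close>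

text \<open>The scaled vector is the mirror image of 0 in the hyperplane {z. z . v = s}. For s = 0
  this image is 0 itself, where \<open>reflection\<close> is junk.\<close>

lemma reflection_scaleR:
  assumes "v \<noteq> 0" "s \<noteq> 0"
  shows "reflection ((2 * s / (v \<bullet> v)) *\<^sub>R v) y = y + (2 * (s - y \<bullet> v) / (v \<bullet> v)) *\<^sub>R v"
  using assms by (simp add: reflection_def field_simps)

text \<open>
  Hyperplanes \<open>{z. z \<bullet> v = s}\<close> are parametrized by \<open>v\<close> and \<open>s\<close>: the reflected point is
  \<open>y + \<tau> v\<close> with \<open>\<tau>\<close> affine in \<open>s\<close>, so that integrating over \<open>(v, s)\<close> with \<open>\<tau> \<in> [1, 2]\<close>
  requires only affine substitutions.
\<close>
lemma nn_integral_reflection_ge: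
  fixes y :: "'a::euclidean_space"
  assumes [measurable]: "Q \<in> sets borel" and y: "norm y < \<rho>" "norm y \<le> \<rho>'" and \<rho>': "\<rho>' < \<rho>"
    and Q: "Q \<subseteq> cball 0 R - ball 0 \<rho>"
  defines "V \<equiv> cball (0::'a) (\<rho> + R)" and "I \<equiv> {0..R\<^sup>2}"
  shows "ennreal ((\<rho> - \<rho>')\<^sup>2) * emeasure lborel Q \<le> 2 ^ (DIM('a) + 3) *
          (\<integral>\<^sup>+v. indicator V v *
            (\<integral>\<^sup>+s. indicator I s * indicator Q (reflection ((2 * s / (v \<bullet> v)) *\<^sub>R v) y) \<partial>lborel) \<partial>lborel)"
proof -
  \<comment> \<open>The weight |x - y|^2 prepares the change of variables: at x = y + \<tau> v it
    equals \<tau>^2 (v . v), while ds = (v . v) / 2 d\<tau>. On \<open>Q\<close> it is at least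
    (\<rho> - \<rho>')^2.\<close>
  define E where "E = (\<integral>\<^sup>+x. ennreal ((norm (x - y))\<^sup>2) * indicator Q x \<partial>lborel)"
  define h where "h v \<tau> = ennreal ((v \<bullet> v) / 2) * (indicator {1..2} \<tau> * indicator Q (y + \<tau> *\<^sub>R v))" for v \<tau>
  have [measurable]: "V \<in> sets borel" "I \<in> sets borel" by (auto simp: V_def I_def)
  have "ennreal ((\<rho> - \<rho>')\<^sup>2) * emeasure lborel Q = (\<integral>\<^sup>+x. ennreal ((\<rho> - \<rho>')\<^sup>2) * indicator Q x \<partial>lborel)"
    by (simp add: nn_integral_cmult)
  also have "\<dots> \<le> E"
    unfolding E_def
  proof (intro nn_integral_mono)
    fix x
    have "x \<in> Q \<Longrightarrow> \<rho> - \<rho>' \<le> norm (x - y)"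
      using Q y \<rho>' norm_triangle_ineq2 [of x y] by auto
    then have "x \<in> Q \<Longrightarrow> (\<rho> - \<rho>')\<^sup>2 \<le> (norm (x - y))\<^sup>2"
      using \<rho>' by (intro power_mono) auto
    then show "ennreal ((\<rho> - \<rho>')\<^sup>2) * indicator Q x \<le> ennreal ((norm (x - y))\<^sup>2) * indicator Q x"
      by (auto simp: indicator_def intro!: ennreal_leI)
  qed
  \<comment> \<open>The interval [1, 2] has length 1. For each \<tau> in it the substitution x = y +
    \<tau> v produces \<tau>^n \<tau>^2 \<le> 2^(n+2), and the 1/2 in \<open>h\<close> costs one
    more factor 2; hence the constant 2^(n+3).\<close>
  also have "E = (\<integral>\<^sup>+\<tau>. E * indicator {1..2::real} \<tau> \<partial>lborel)"
    by (simp add: nn_integral_cmult)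
  also have "\<dots> \<le> (\<integral>\<^sup>+\<tau>. 2 ^ (DIM('a) + 3) * (\<integral>\<^sup>+v. h v \<tau> \<partial>lborel) \<partial>lborel)"
  proof (intro nn_integral_mono)
    fix \<tau> :: real
    show "E * indicator {1..2} \<tau> \<le> 2 ^ (DIM('a) + 3) * (\<integral>\<^sup>+v. h v \<tau> \<partial>lborel)"
    proof (cases "\<tau> \<in> {1..2}")
      case True
      then have "\<tau> \<noteq> 0" by auto
      have "E = (\<integral>\<^sup>+v. ennreal (\<bar>\<tau>\<bar> ^ DIM('a)) *
                  (ennreal ((norm (y + \<tau> *\<^sub>R v - y))\<^sup>2) * indicator Q (y + \<tau> *\<^sub>R v)) \<partial>lborel)"
        unfolding E_def
        by (subst lborel_affine [OF \<open>\<tau> \<noteq> 0\<close>, of y]) (simp add: nn_integral_density nn_integral_distr)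
      also have "\<dots> \<le> (\<integral>\<^sup>+v. 2 ^ (DIM('a) + 3) * h v \<tau> \<partial>lborel)"
      proof (intro nn_integral_mono)
        fix v :: 'a
        have "\<tau> ^ DIM('a) * (\<tau> ^ 2 * (v \<bullet> v)) = \<tau> ^ (DIM('a) + 2) * (v \<bullet> v)"
          by (simp add: power_add power2_eq_square)
        also have "\<dots> \<le> 2 ^ (DIM('a) + 2) * (v \<bullet> v)"
          using True by (intro mult_right_mono power_mono) auto
        also have "\<dots> = 2 ^ (DIM('a) + 3) * ((v \<bullet> v) / 2)"
          by (simp add: power_add)
        finally have "ennreal (\<tau> ^ DIM('a) * (\<tau> ^ 2 * (v \<bullet> v))) \<le> 2 ^ (DIM('a) + 3) * ennreal ((v \<bullet> v) / 2)"
          by (subst ennreal_numeral [symmetric], subst ennreal_power, simp,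
              subst ennreal_mult [symmetric]) (auto intro!: ennreal_leI)
        then show "ennreal (\<bar>\<tau>\<bar> ^ DIM('a)) *
                  (ennreal ((norm (y + \<tau> *\<^sub>R v - y))\<^sup>2) * indicator Q (y + \<tau> *\<^sub>R v)) \<le> 2 ^ (DIM('a) + 3) * h v \<tau>"
          using True
          by (auto simp: h_def indicator_def power_mult_distrib power2_norm_eq_inner simp flip: ennreal_mult)
      qed
      also have "\<dots> = 2 ^ (DIM('a) + 3) * (\<integral>\<^sup>+v. h v \<tau> \<partial>lborel)"
        unfolding h_def by (simp add: nn_integral_cmult)
      finally show ?thesis
        by (simp add: indicator_def)
    qed simp
  qed
  also have "\<dots> = 2 ^ (DIM('a) + 3) * (\<integral>\<^sup>+\<tau>. \<integral>\<^sup>+v. h v \<tau> \<partial>lborel \<partial>lborel)"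
    unfolding h_def by (simp add: nn_integral_cmult)
  also have "(\<integral>\<^sup>+\<tau>. \<integral>\<^sup>+v. h v \<tau> \<partial>lborel \<partial>lborel) = (\<integral>\<^sup>+v. \<integral>\<^sup>+\<tau>. h v \<tau> \<partial>lborel \<partial>lborel)"
    unfolding h_def by (rule lborel_pair.Fubini') measurable
  also have "\<dots> \<le> (\<integral>\<^sup>+v. indicator V v *
            (\<integral>\<^sup>+s. indicator I s * indicator Q (reflection ((2 * s / (v \<bullet> v)) *\<^sub>R v) y) \<partial>lborel) \<partial>lborel)"
  proof (intro nn_integral_mono)
    fix v :: 'a
    let ?q = "\<lambda>s. indicator Q (reflection ((2 * s / (v \<bullet> v)) *\<^sub>R v) y) :: ennreal"
    show "(\<integral>\<^sup>+\<tau>. h v \<tau> \<partial>lborel) \<le> indicator V v * (\<integral>\<^sup>+s. indicator I s * ?q s \<partial>lborel)"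
    proof (cases "v = 0")
      case False
      have "indicator V v * (\<integral>\<^sup>+s. indicator I s * ?q s \<partial>lborel) = indicator V v * (\<integral>\<^sup>+\<tau>. ennreal ((v \<bullet> v) / 2) *
              (indicator I (y \<bullet> v + (v \<bullet> v) / 2 * \<tau>) * ?q (y \<bullet> v + (v \<bullet> v) / 2 * \<tau>)) \<partial>lborel)"
        using False
        by (subst nn_integral_real_affine [where c = "(v \<bullet> v) / 2" and t = "y \<bullet> v"]) (simp_all add: nn_integral_cmult)
      also have "\<dots> = (\<integral>\<^sup>+\<tau>. indicator V v * (ennreal ((v \<bullet> v) / 2) *
              (indicator I (y \<bullet> v + (v \<bullet> v) / 2 * \<tau>) * ?q (y \<bullet> v + (v \<bullet> v) / 2 * \<tau>))) \<partial>lborel)"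
        by (simp add: nn_integral_cmult)
      also have "\<dots> \<ge> (\<integral>\<^sup>+\<tau>. h v \<tau> \<partial>lborel)"
      proof (intro nn_integral_mono)
        fix \<tau> :: real
        define s where "s = y \<bullet> v + (v \<bullet> v) / 2 * \<tau>"
        show "h v \<tau> \<le> indicator V v * (ennreal ((v \<bullet> v) / 2) *
              (indicator I (y \<bullet> v + (v \<bullet> v) / 2 * \<tau>) * ?q (y \<bullet> v + (v \<bullet> v) / 2 * \<tau>)))"
        proof (cases "\<tau> \<in> {1..2} \<and> y + \<tau> *\<^sub>R v \<in> Q")
          case True
          define x where "x = y + \<tau> *\<^sub>R v"
          have x: "\<rho> \<le> norm x" "norm x \<le> R" and \<tau>: "1 \<le> \<tau>" "\<tau> \<le> 2"
            using True Q by (auto simp: x_def)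
          have "norm v \<le> \<tau> * norm v" using \<tau> by (simp add: mult_le_cancel_right1)
          also have "\<dots> = norm (x - y)" using \<tau> by (simp add: x_def)
          also have "\<dots> \<le> R + \<rho>" using norm_triangle_ineq4 [of x y] x y by simp
          finally have V: "v \<in> V" by (simp add: V_def)
          \<comment> \<open>The hyperplane {z. z . v = s} passes through the midpoint of x and y,
            and \<tau> v = x - y. As x is farther from the origin than y, this makes s positive, and
            the bound R on |x| puts it into \<open>I\<close>.\<close>
          have s2: "2 * \<tau> * s = (norm x)\<^sup>2 - (norm y)\<^sup>2"
            unfolding power2_norm_eq_inner s_def x_def
            by (simp add: inner_add_left inner_add_right algebra_simps inner_commute)
          have "(norm y)\<^sup>2 < (norm x)\<^sup>2"
            using x y by (intro power_strict_mono) auto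
          then have "0 < 2 * \<tau> * s" by (simp add: s2)
          then have s: "0 < s" using \<tau> by (simp add: zero_less_mult_iff)
          have "s \<le> 2 * \<tau> * s" using s \<tau> by (simp add: mult_le_cancel_right1)
          also have "\<dots> \<le> (norm x)\<^sup>2" by (simp add: s2)
          also have "\<dots> \<le> R\<^sup>2" using x by (intro power_mono) auto
          finally have I: "s \<in> I" using s by (simp add: I_def)
          have "2 * (s - y \<bullet> v) / (v \<bullet> v) = \<tau>"
            using False by (simp add: s_def)
          then have "reflection ((2 * s / (v \<bullet> v)) *\<^sub>R v) y = x"
            using reflection_scaleR [OF False, of s y] s by (simp add: x_def)
          then show ?thesis
            unfolding s_def [symmetric] using V I True by (simp add: h_def x_def)
        qed (auto simp: h_def)
      qed
      finally show ?thesis .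
    qed (simp add: h_def)
  qed
  finally show ?thesis
    by (simp add: mult_left_mono)
qed

text \<open>A mean value argument: integrated over the hyperplane parameters, the measure of the
  points of \<open>P\<close> reflected into \<open>Q\<close> has a lower bound independent of
  \<open>P\<close> and \<open>Q\<close>, and the parameter set \<open>V\<close> times
  \<open>I\<close> has finite measure \<open>K\<close>.\<close>

lemma exists_reflection_emeasure_ge:
  fixes \<epsilon> \<rho> R :: real
  assumes \<epsilon>: "0 < \<epsilon>" and \<rho>: "0 < \<rho>" and R: "0 < R"
  obtains c where "0 < c"
    and "\<And>P Q :: 'a::euclidean_space set. \<lbrakk>P \<in> sets borel; Q \<in> sets borel; P \<subseteq> ball 0 \<rho>; Q \<subseteq> cball 0 R - ball 0 \<rho>;
           \<epsilon> \<le> measure lborel P; \<epsilon> \<le> measure lborel Q\<rbrakk>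
           \<Longrightarrow> \<exists>w. w \<noteq> 0 \<and> ennreal c < emeasure lborel {y \<in> P. reflection w y \<in> Q}"
proof -
  let ?n = "DIM('a)"
  let ?vol = "\<lambda>r. unit_ball_vol (real ?n) * r ^ ?n"
  \<comment> \<open>\<open>P\<close> and \<open>Q\<close> may touch along the sphere of radius
    \<rho>, where the distance estimate degenerates. The shell between \<rho>' and \<rho> is made
    thinner than \<epsilon> / 2 in volume; the rest of \<open>P\<close> keeps volume at least
    \<epsilon> / 2 and has distance at least \<rho> - \<rho>' from \<open>Q\<close>.\<close>
  have "(?vol \<longlongrightarrow> ?vol \<rho>) (at_left \<rho>)" by (intro tendsto_intros)
  then have "\<forall>\<^sub>F r in at_left \<rho>. ?vol \<rho> - \<epsilon> / 2 < ?vol r"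
    using \<epsilon> by (intro order_tendstoD) auto
  moreover have "\<forall>\<^sub>F r in at_left \<rho>. r \<in> {0<..<\<rho>}"
    using \<rho> by (intro eventually_at_left_real)
  ultimately have "\<exists>r. ?vol \<rho> - \<epsilon> / 2 < ?vol r \<and> r \<in> {0<..<\<rho>}"
    by (intro eventually_happens' [OF trivial_limit_at_left_real] eventually_conj)
  then obtain \<rho>' where \<rho>': "0 < \<rho>'" "\<rho>' < \<rho>" "?vol \<rho> - \<epsilon> / 2 < ?vol \<rho>'"
    using that by (metis greaterThanLessThan_iff)
  define V where "V = cball (0::'a) (\<rho> + R)"
  define I where "I = {0..R\<^sup>2}"
  have [measurable]: "V \<in> sets borel" "I \<in> sets borel" by (auto simp: V_def I_def)
  define K where "K = ?vol (\<rho> + R) * R\<^sup>2"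
  have K: "0 < K" using \<rho> R by (simp add: K_def)
  have VI: "emeasure lborel V * emeasure lborel I = ennreal K"
    using \<rho> R by (simp add: V_def I_def K_def emeasure_cball ennreal_mult)
  \<comment> \<open>\<open>t\<close> bounds (\<rho> - \<rho>')^2 |Q| |P'| from below, with
    \<open>P'\<close> the part of \<open>P\<close> within radius \<rho>'. The average over the
    parameters is then at least t / (2^(n+3) K); \<open>c\<close> is half of this, which makes the
    inequality strict.\<close>
  define t where "t = (\<rho> - \<rho>')\<^sup>2 * \<epsilon> * (\<epsilon> / 2)"
  have t: "0 < t" using \<rho>' \<epsilon> by (simp add: t_def)
  define c where "c = t / (2 ^ (?n + 3) * K) / 2"
  have c: "0 < c" using t K by (simp add: c_def)
  show ?thesis
  proof (rule that [OF c])
    fix P Q :: "'a set"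
    assume [measurable]: "P \<in> sets borel" "Q \<in> sets borel"
      and P: "P \<subseteq> ball 0 \<rho>" and Q: "Q \<subseteq> cball 0 R - ball 0 \<rho>"
      and \<epsilon>P: "\<epsilon> \<le> measure lborel P" and \<epsilon>Q: "\<epsilon> \<le> measure lborel Q"
    let ?W = "\<lambda>v s. (2 * s / (v \<bullet> v)) *\<^sub>R v :: 'a"
    let ?N = "\<lambda>w. {y \<in> P. reflection w y \<in> Q}"
    let ?g = "\<lambda>v s y. indicator V v * (indicator I s * (indicator P y * indicator Q (reflection (?W v s) y))) :: ennreal"
    define P' where "P' = P \<inter> cball 0 \<rho>'"
    have [measurable]: "P' \<in> sets borel" by (auto simp: P'_def)
    have fin: "emeasure lborel X < \<infinity>" if "X \<subseteq> cball 0 r" for X :: "'a set" and r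
      using that emeasure_bounded_finite bounded_subset bounded_cball by blast
    have finP: "emeasure lborel P = ennreal (measure lborel P)" "emeasure lborel P' = ennreal (measure lborel P')"
      using fin [OF subset_trans [OF P ball_subset_cball]] fin [of P' \<rho>'] by (auto simp: P'_def emeasure_eq_ennreal_measure)
    have finQ: "emeasure lborel Q = ennreal (measure lborel Q)"
      using fin [OF subset_trans [OF Q Diff_subset]] by (auto simp: emeasure_eq_ennreal_measure)
    have "emeasure lborel P \<le> emeasure lborel (P' \<union> (ball 0 \<rho> - cball 0 \<rho>'))"
      using P by (intro emeasure_mono) (auto simp: P'_def)
    also have "\<dots> \<le> emeasure lborel P' + emeasure lborel (ball 0 \<rho> - cball (0::'a) \<rho>')"
      by (intro emeasure_subadditive) auto
    also have "emeasure lborel (ball 0 \<rho> - cball (0::'a) \<rho>') = ennreal (?vol \<rho> - ?vol \<rho>')"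
      using \<rho> \<rho>' by (subst emeasure_Diff) (auto simp: emeasure_ball emeasure_cball ennreal_minus)
    also have "\<dots> \<le> ennreal (\<epsilon> / 2)" using \<rho>' by (intro ennreal_leI) simp
    finally have "measure lborel P \<le> measure lborel P' + \<epsilon> / 2"
      using \<epsilon> by (simp add: finP add_left_mono flip: ennreal_plus)
    then have \<epsilon>P': "\<epsilon> / 2 \<le> measure lborel P'" using \<epsilon>P by simp
    have "t \<le> (\<rho> - \<rho>')\<^sup>2 * measure lborel Q * measure lborel P'"
      unfolding t_def using \<epsilon>P' \<epsilon>Q \<epsilon> by (intro mult_mono) auto
    then have "ennreal t \<le> ennreal ((\<rho> - \<rho>')\<^sup>2) * emeasure lborel Q * emeasure lborel P'"
      unfolding finP finQ by (simp add: ennreal_leI flip: ennreal_mult)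
    also have "\<dots> = (\<integral>\<^sup>+y. ennreal ((\<rho> - \<rho>')\<^sup>2) * emeasure lborel Q * indicator P' y \<partial>lborel)"
      by (simp add: nn_integral_cmult)
    also have "\<dots> \<le> (\<integral>\<^sup>+y. 2 ^ (?n + 3) * (\<integral>\<^sup>+v. \<integral>\<^sup>+s. ?g v s y \<partial>lborel \<partial>lborel) \<partial>lborel)"
    proof (intro nn_integral_mono)
      fix y
      show "ennreal ((\<rho> - \<rho>')\<^sup>2) * emeasure lborel Q * indicator P' y
              \<le> 2 ^ (?n + 3) * (\<integral>\<^sup>+v. \<integral>\<^sup>+s. ?g v s y \<partial>lborel \<partial>lborel)"
      proof (cases "y \<in> P'")
        case True
        then have "norm y < \<rho>" "norm y \<le> \<rho>'" "y \<in> P"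
          using P by (auto simp: P'_def)
        then show ?thesis
          using nn_integral_reflection_ge [of Q y \<rho> \<rho>' R] Q \<rho>' True
          by (simp add: V_def I_def nn_integral_cmult)
      qed simp
    qed
    also have "\<dots> = 2 ^ (?n + 3) * (\<integral>\<^sup>+y. \<integral>\<^sup>+v. \<integral>\<^sup>+s. ?g v s y \<partial>lborel \<partial>lborel \<partial>lborel)"
      by (simp add: nn_integral_cmult)
    also have "(\<integral>\<^sup>+y. \<integral>\<^sup>+v. \<integral>\<^sup>+s. ?g v s y \<partial>lborel \<partial>lborel \<partial>lborel) =
               (\<integral>\<^sup>+v. \<integral>\<^sup>+y. \<integral>\<^sup>+s. ?g v s y \<partial>lborel \<partial>lborel \<partial>lborel)"
      by (rule lborel_pair.Fubini') measurable
    also have "\<dots> = (\<integral>\<^sup>+v. \<integral>\<^sup>+s. \<integral>\<^sup>+y. ?g v s y \<partial>lborel \<partial>lborel \<partial>lborel)"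
      by (intro nn_integral_cong lborel_pair.Fubini') measurable
    also have "\<dots> = (\<integral>\<^sup>+v. \<integral>\<^sup>+s. indicator V v * (indicator I s * emeasure lborel (?N (?W v s))) \<partial>lborel \<partial>lborel)"
    proof (intro nn_integral_cong)
      fix v :: 'a and s :: real
      have "?N (?W v s) \<in> sets borel" by measurable
      then have "emeasure lborel (?N (?W v s)) = (\<integral>\<^sup>+y. indicator (?N (?W v s)) y \<partial>lborel)"
        by (subst nn_integral_indicator) simp_all
      also have "\<dots> = (\<integral>\<^sup>+y. indicator P y * indicator Q (reflection (?W v s) y) \<partial>lborel)"
        by (intro nn_integral_cong) (auto simp: indicator_def)
      finally have "emeasure lborel (?N (?W v s)) = \<dots>" .
      then show "(\<integral>\<^sup>+y. ?g v s y \<partial>lborel) = indicator V v * (indicator I s * emeasure lborel (?N (?W v s)))"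
        by (simp add: nn_integral_cmult)
    qed
    finally have *: "ennreal t \<le> 2 ^ (?n + 3) *
        (\<integral>\<^sup>+v. \<integral>\<^sup>+s. indicator V v * (indicator I s * emeasure lborel (?N (?W v s))) \<partial>lborel \<partial>lborel)" .
    show "\<exists>w. w \<noteq> 0 \<and> ennreal c < emeasure lborel (?N w)"
    proof (rule ccontr)
      assume "\<not> ?thesis"
      then have le: "w \<noteq> 0 \<Longrightarrow> emeasure lborel (?N w) \<le> ennreal c" for w by force
      \<comment> \<open>For v = 0 or s = 0 the parameter vector is 0 and \<open>reflection\<close>
        is the identity; such parameters contribute nothing because \<open>P\<close> and
        \<open>Q\<close> are disjoint.\<close>
      have N0: "?N 0 = {}" using P Q by (force simp: reflection_def)
      have le: "emeasure lborel (?N w) \<le> ennreal c" for w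
        using le [of w] arg_cong [OF N0, of "emeasure lborel"] by (cases "w = 0") (simp_all only: emeasure_empty zero_le not_False_eq_True)
      have "(\<integral>\<^sup>+v. \<integral>\<^sup>+s. indicator V v * (indicator I s * emeasure lborel (?N (?W v s))) \<partial>lborel \<partial>lborel)
            \<le> (\<integral>\<^sup>+v. \<integral>\<^sup>+s. indicator V v * (indicator I s * ennreal c) \<partial>lborel \<partial>lborel)"
        by (intro nn_integral_mono mult_left_mono le) auto
      also have "\<dots> = ennreal (K * c)"
      proof -
        have "(\<integral>\<^sup>+v. \<integral>\<^sup>+s. indicator V v * (indicator I s * ennreal c) \<partial>lborel \<partial>lborel)
              = emeasure lborel V * emeasure lborel I * ennreal c"
          by (simp add: nn_integral_cmult nn_integral_multc mult.assoc)
        then show ?thesis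
          using K c by (simp only: VI ennreal_mult less_imp_le)
      qed
      finally have "ennreal t \<le> 2 ^ (?n + 3) * ennreal (K * c)"
        using * by (meson mult_left_mono order_trans zero_le)
      also have "\<dots> = ennreal (t / 2)"
      proof -
        have "2 ^ (?n + 3) * ennreal (K * c) = ennreal (2 ^ (?n + 3)) * ennreal (K * c)"
          by (simp flip: ennreal_power)
        also have "\<dots> = ennreal (2 ^ (?n + 3) * (K * c))"
          using K c by (simp only: ennreal_mult less_imp_le zero_le_power zero_le_numeral mult_nonneg_nonneg)
        also have "2 ^ (?n + 3) * (K * c) = t / 2"
          using K by (simp add: c_def)
        finally show ?thesis .
      qed
      finally show False using t by (simp add: ennreal_le_iff)
    qed
  qed
qed

section \<open>Riesz' inequality for sets\<close>

text \<open>Total volume is preserved, so a gain inside the ball is a loss outside; the bounding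
  ball makes all volumes finite, so that they can be subtracted.\<close>

lemma deficit_polarization:
  fixes A :: "'a::euclidean_space set"
  assumes w: "w \<noteq> 0" and [measurable]: "A \<in> sets borel" and A: "A \<subseteq> cball 0 R"
  shows "measure lborel (polarization w A - ball 0 \<rho>) + measure lborel {x \<in> ball 0 \<rho> - A. reflection w x \<in> A - ball 0 \<rho>}
           \<le> measure lborel (A - ball 0 \<rho>)"
proof -
  define S where "S = ball (0 :: 'a) \<rho>"
  define N where "N = {x \<in> S - A. reflection w x \<in> A - S}"
  have [measurable]: "S \<in> sets borel" by (simp add: S_def)
  have [measurable]: "reflection w \<in> borel_measurable borel" by measurable
  have [measurable]: "N \<in> sets borel" unfolding N_def by measurable
  have [measurable]: "polarization w A \<in> sets borel" by (rule polarization_borel) fact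
  have fin: "X \<in> fmeasurable lborel" if "X \<in> sets borel" "X \<subseteq> S \<or> X \<subseteq> cball 0 R" for X
  proof (rule fmeasurableI)
    have "bounded X"
      using that bounded_subset bounded_cball [of 0 R] bounded_ball [of 0 \<rho>] unfolding S_def by blast
    then show "emeasure lborel X < \<infinity>" by (rule emeasure_bounded_finite)
  qed (use that in simp)
  have split: "measure lborel (X \<inter> S) + measure lborel (X - S) = measure lborel X"
    if "X \<in> sets borel" "X \<subseteq> cball 0 R" for X
  proof -
    have "measure lborel ((X \<inter> S) \<union> (X - S)) = measure lborel (X \<inter> S) + measure lborel (X - S)"
      using that by (intro measure_Un_AE fin AE_I2) auto
    moreover have "(X \<inter> S) \<union> (X - S) = X" by auto
    ultimately show ?thesis by simp
  qed
  have "emeasure lborel (A \<inter> S) + emeasure lborel N \<le> emeasure lborel (polarization w A \<inter> S)"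
    using emeasure_polarization_Int_ball [OF w assms(2), of \<rho>] by (simp only: N_def S_def)
  moreover have "A \<inter> S \<in> fmeasurable lborel" "N \<in> fmeasurable lborel" "polarization w A \<inter> S \<in> fmeasurable lborel"
    by (intro fin; force simp: N_def)+
  ultimately have "measure lborel (A \<inter> S) + measure lborel N \<le> measure lborel (polarization w A \<inter> S)"
    by (simp add: emeasure_eq_measure2 flip: ennreal_plus)
  moreover have "measure lborel (polarization w A) = measure lborel A"
    using emeasure_polarization [OF w assms(2)] by (simp add: measure_def)
  ultimately show ?thesis
    using split [of A] split [of "polarization w A"] A polarization_subset_cball [OF w A]
    by (simp add: N_def S_def)
qed

lemma energy_le_measure:
  assumes [measurable]: "A \<in> sets borel" "B \<in> sets borel" "J \<in> borel_measurable borel"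
    and J: "\<And>x y. norm x \<le> norm y \<Longrightarrow> J y \<le> J x"
  shows "energy J A B \<le> ennreal (J 0) * (emeasure lborel A * emeasure lborel B)"
proof -
  have "energy J A B \<le> (\<integral>\<^sup>+x. \<integral>\<^sup>+y. indicator A x * indicator B y * ennreal (J 0) \<partial>lborel \<partial>lborel)"
    unfolding energy_def by (intro nn_integral_mono mult_left_mono ennreal_leI J) auto
  also have "\<dots> = ennreal (J 0) * (emeasure lborel A * emeasure lborel B)"
    by (simp add: nn_integral_cmult nn_integral_multc mult_ac)
  finally show ?thesis .
qed

text \<open>A times B is covered by S times T, (A - S) times B and S times (B - T), and the kernel
  is at most \<open>J 0\<close>. This Lipschitz estimate in the deficits takes the place of a
  passage to the limit.\<close>

lemma energy_le_energy_plus_measure: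
  assumes [measurable]: "A \<in> sets borel" "B \<in> sets borel" "S \<in> sets borel" "T \<in> sets borel" "J \<in> borel_measurable borel"
    and J: "\<And>x y. norm x \<le> norm y \<Longrightarrow> J y \<le> J x"
  shows "energy J A B \<le> energy J S T + ennreal (J 0) *
          (emeasure lborel (A - S) * emeasure lborel B + emeasure lborel S * emeasure lborel (B - T))"
proof -
  have "energy J A B \<le> energy J S T + (energy J (A - S) B + energy J S (B - T))"
  proof -
    let ?F = "\<lambda>A B x y. indicator A x * indicator B y * ennreal (J (x - y)) :: ennreal"
    have "energy J A B \<le> (\<integral>\<^sup>+x. \<integral>\<^sup>+y. ?F S T x y + (?F (A - S) B x y + ?F S (B - T) x y) \<partial>lborel \<partial>lborel)"
      unfolding energy_def by (intro nn_integral_mono) (auto simp: indicator_def)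
    also have "\<dots> = energy J S T + (energy J (A - S) B + energy J S (B - T))"
      unfolding energy_def by (simp add: nn_integral_add)
    finally show ?thesis .
  qed
  also have "\<dots> \<le> energy J S T + (ennreal (J 0) * (emeasure lborel (A - S) * emeasure lborel B) +
                 ennreal (J 0) * (emeasure lborel S * emeasure lborel (B - T)))"
    by (intro add_left_mono add_mono energy_le_measure J) auto
  finally show ?thesis by (simp add: distrib_left)
qed

theorem energy_le_energy_ball:
  fixes A B :: "'a::euclidean_space set"
  assumes A: "A \<in> sets borel" "A \<subseteq> cball 0 R" "emeasure lborel A = emeasure lborel (ball (0::'a) \<alpha>)"
    and B: "B \<in> sets borel" "B \<subseteq> cball 0 R" "emeasure lborel B = emeasure lborel (ball (0::'a) \<beta>)"
    and J_meas [measurable]: "J \<in> borel_measurable borel" and J: "\<And>x y. norm x \<le> norm y \<Longrightarrow> J y \<le> J x"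
  shows "energy J A B \<le> energy J (ball 0 \<alpha>) (ball 0 \<beta>)"
proof (cases "0 < \<alpha> \<and> 0 < \<beta>")
  case False
  then have "emeasure lborel A = 0 \<or> emeasure lborel B = 0"
    using A B by (auto simp: not_less ball_empty)
  then have "energy J A B \<le> 0"
    using energy_le_measure [OF A(1) B(1) J_meas J] by auto
  then show ?thesis by simp
next
  case True
  then have pos: "0 < \<alpha>" "0 < \<beta>" by auto
  define R' where "R' = max R 1"
  have R': "0 < R'" "cball (0::'a) R \<subseteq> cball 0 R'" by (auto simp: R'_def)
  define Adm where "Adm = (\<lambda>(X, Y). X \<in> sets borel \<and> X \<subseteq> cball 0 R' \<and> emeasure lborel X = emeasure lborel A \<and>
     Y \<in> sets borel \<and> Y \<subseteq> cball 0 R' \<and> emeasure lborel Y = emeasure lborel B \<and> energy J A B \<le> energy J X Y)"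
  define D where "D \<rho> X = measure lborel (X - ball (0::'a) \<rho>)" for \<rho> X
  define d where "d = (\<lambda>(X, Y). D \<alpha> X + D \<beta> Y)"
  have Adm0: "Adm (A, B)" using A B R' by (auto simp: Adm_def)
  have d_nonneg: "0 \<le> d p" for p by (auto simp: d_def D_def split: prod.split)
  have pol_D: "D \<rho> (polarization w X) \<le> D \<rho> X"
    if "w \<noteq> 0" "X \<in> sets borel" "X \<subseteq> cball 0 R'" for w X \<rho>
    using deficit_polarization [OF that, of \<rho>] measure_nonneg [of lborel] unfolding D_def by (smt (verit))
  have fin: "X \<in> fmeasurable lborel" if "X \<in> sets borel" "bounded X" for X :: "'a set"
    using that by (intro fmeasurableI emeasure_bounded_finite) auto
  have gain: "\<exists>c>0. \<forall>X. X \<in> sets borel \<and> X \<subseteq> cball 0 R' \<and> emeasure lborel X = emeasure lborel (ball (0::'a) \<rho>) \<and> \<epsilon> \<le> D \<rho> X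
                \<longrightarrow> (\<exists>w. w \<noteq> 0 \<and> D \<rho> (polarization w X) + c \<le> D \<rho> X)" if pos: "0 < \<rho>" "0 < \<epsilon>" for \<rho> \<epsilon>
  proof -
    obtain c where c: "0 < c" "\<And>P Q :: 'a set. \<lbrakk>P \<in> sets borel; Q \<in> sets borel; P \<subseteq> ball 0 \<rho>; Q \<subseteq> cball 0 R' - ball 0 \<rho>;
           \<epsilon> \<le> measure lborel P; \<epsilon> \<le> measure lborel Q\<rbrakk>
           \<Longrightarrow> \<exists>w. w \<noteq> 0 \<and> ennreal c < emeasure lborel {y \<in> P. reflection w y \<in> Q}"
      using exists_reflection_emeasure_ge [OF pos(2,1) R'(1)] by blast
    show ?thesis
    proof (rule exI [of _ c], intro conjI c(1) allI impI, elim conjE)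
      fix X assume X: "X \<in> sets borel" "X \<subseteq> cball 0 R'" "emeasure lborel X = emeasure lborel (ball (0::'a) \<rho>)" "\<epsilon> \<le> D \<rho> X"
      let ?S = "ball (0::'a) \<rho>"
      have bX: "bounded X" using X(2) bounded_cball bounded_subset by blast
      have diff: "measure lborel (Y - Z) = measure lborel Y - measure lborel (Y \<inter> Z)"
        if "Y \<in> sets borel" "bounded Y" "Z \<in> sets borel" for Y Z :: "'a set"
      proof -
        have "measure lborel (Y - Y \<inter> Z) = measure lborel Y - measure lborel (Y \<inter> Z)"
          using that fmeasurableD2 [OF fin [OF that(1,2)]] by (intro measure_Diff) auto
        moreover have "Y - Y \<inter> Z = Y - Z" by auto
        ultimately show ?thesis by simp
      qed
      \<comment> \<open>\<open>X\<close> has the volume of the ball, so the missing part has the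
        volume of the excess; both are at least \<epsilon>, as the averaging lemma requires.\<close>
      have "measure lborel (?S - X) = measure lborel ?S - measure lborel (?S \<inter> X)"
        using X(1) by (intro diff) auto
      moreover have "measure lborel (X - ?S) = measure lborel X - measure lborel (?S \<inter> X)"
        using X(1) bX by (subst Int_commute, intro diff) auto
      ultimately have "\<epsilon> \<le> measure lborel (?S - X)"
        using X(3,4) by (simp add: D_def measure_def)
      then obtain w where w: "w \<noteq> 0" "ennreal c < emeasure lborel {y \<in> ?S - X. reflection w y \<in> X - ?S}"
        using c(2) [of "?S - X" "X - ?S"] X by (auto simp: D_def)
      let ?N = "{y \<in> ?S - X. reflection w y \<in> X - ?S}"
      have "bounded ?N" by (rule bounded_subset [OF bounded_ball [of 0 \<rho>]]) auto
      from emeasure_bounded_finite [OF this, unfolded infinity_ennreal_def, THEN less_imp_neq]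
      have "emeasure lborel ?N = ennreal (measure lborel ?N)"
        by (rule emeasure_eq_ennreal_measure)
      then have "c < measure lborel ?N" using w(2) c(1) by (simp add: ennreal_less_iff)
      then show "\<exists>w. w \<noteq> 0 \<and> D \<rho> (polarization w X) + c \<le> D \<rho> X"
        using deficit_polarization [OF w(1) X(1,2), of \<rho>] w(1) by (intro exI [of _ w]) (simp add: D_def)
    qed
  qed
  have small: "\<exists>p. Adm p \<and> d p < \<delta>" if \<delta>: "0 < \<delta>" for \<delta>
  proof (rule ccontr)
    assume neg: "\<nexists>p. Adm p \<and> d p < \<delta>"
    obtain c1 where c1: "0 < c1" "\<And>X. \<lbrakk>X \<in> sets borel; X \<subseteq> cball 0 R'; emeasure lborel X = emeasure lborel A; \<delta> / 2 \<le> D \<alpha> X\<rbrakk>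
                \<Longrightarrow> \<exists>w. w \<noteq> 0 \<and> D \<alpha> (polarization w X) + c1 \<le> D \<alpha> X"
      using gain [OF pos(1), of "\<delta> / 2"] \<delta> A(3) by auto
    obtain c2 where c2: "0 < c2" "\<And>X. \<lbrakk>X \<in> sets borel; X \<subseteq> cball 0 R'; emeasure lborel X = emeasure lborel B; \<delta> / 2 \<le> D \<beta> X\<rbrakk>
                \<Longrightarrow> \<exists>w. w \<noteq> 0 \<and> D \<beta> (polarization w X) + c2 \<le> D \<beta> X"
      using gain [OF pos(2), of "\<delta> / 2"] \<delta> B(3) by auto
    define m where "m = (INF p\<in>Collect Adm. d p)"
    have bdd: "bdd_below (d ` Collect Adm)" using d_nonneg by (intro bdd_belowI [of _ 0]) auto
    \<comment> \<open>The infimum need not be attained: for a competitor within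
      \<open>min c1 c2\<close> of it, one polarization gains at least that much and lands strictly
      below \<open>m\<close>.\<close>
    have "m < m + min c1 c2" using c1 c2 by simp
    then obtain X Y where XY: "Adm (X, Y)" "d (X, Y) < m + min c1 c2"
      unfolding m_def using cINF_less_iff [OF _ bdd, of "m + min c1 c2"] Adm0 m_def by (metis (mono_tags, lifting) empty_iff mem_Collect_eq surj_pair)
    have X: "X \<in> sets borel" "X \<subseteq> cball 0 R'" "emeasure lborel X = emeasure lborel A"
      and Y: "Y \<in> sets borel" "Y \<subseteq> cball 0 R'" "emeasure lborel Y = emeasure lborel B"
      and E: "energy J A B \<le> energy J X Y"
      using XY(1) by (auto simp: Adm_def)
    have "\<delta> \<le> D \<alpha> X + D \<beta> Y" using neg XY(1) by (auto simp: d_def not_less)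
    then have "\<delta> / 2 \<le> D \<alpha> X \<or> \<delta> / 2 \<le> D \<beta> Y" by auto
    then obtain w where w: "w \<noteq> 0" and "D \<alpha> (polarization w X) + min c1 c2 \<le> D \<alpha> X \<or> D \<beta> (polarization w Y) + min c1 c2 \<le> D \<beta> Y"
      using c1(2) [OF X] c2(2) [OF Y] by (smt (verit))
    then have "d (polarization w X, polarization w Y) + min c1 c2 \<le> d (X, Y)"
      using pol_D [OF w X(1,2), of \<alpha>] pol_D [OF w Y(1,2), of \<beta>] by (auto simp: d_def)
    moreover have "Adm (polarization w X, polarization w Y)"
      using X Y E order_trans [OF E energy_le_polarization [OF w X(1) Y(1) J_meas J]] polarization_subset_cball [OF w]
      by (auto simp: Adm_def emeasure_polarization [OF w] polarization_borel)
    then have "m \<le> d (polarization w X, polarization w Y)"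
      unfolding m_def by (intro cINF_lower bdd) auto
    ultimately show False using XY(2) by simp
  qed
  define K where "K = J 0 * (measure lborel B + measure lborel (ball (0::'a) \<alpha>))"
  show ?thesis
  proof (cases "0 \<le> J 0")
    case False
    then have "energy J A B \<le> 0"
      using energy_le_measure [OF A(1) B(1) J_meas J] by (simp add: ennreal_neg)
    then show ?thesis by simp
  next
    case J0: True
    then have K: "0 \<le> K" by (simp add: K_def)
    show ?thesis
    proof (rule ennreal_le_epsilon)
      fix e :: real assume e: "0 < e"
      \<comment> \<open>\<open>K\<close> is the factor of the deficit sum in the Lipschitz estimate;
        dividing by \<open>K + 1\<close> guards against K = 0.\<close>
      obtain X Y where XY: "Adm (X, Y)" "d (X, Y) < e / (K + 1)"
        using small [of "e / (K + 1)"] K e by auto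
      have X: "X \<in> sets borel" "X \<subseteq> cball 0 R'" "emeasure lborel X = emeasure lborel A"
        and Y: "Y \<in> sets borel" "Y \<subseteq> cball 0 R'" "emeasure lborel Y = emeasure lborel B"
        and E: "energy J A B \<le> energy J X Y"
        using XY(1) by (auto simp: Adm_def)
      have b: "bounded X" "bounded Y" using X(2) Y(2) bounded_cball bounded_subset by blast+
      have eq: "emeasure lborel (X - ball 0 \<alpha>) = ennreal (D \<alpha> X)" "emeasure lborel (Y - ball 0 \<beta>) = ennreal (D \<beta> Y)"
        "emeasure lborel Y = ennreal (measure lborel Y)" "emeasure lborel (ball (0::'a) \<alpha>) = ennreal (measure lborel (ball (0::'a) \<alpha>))"
        unfolding D_def using X(1) Y(1) b by (intro emeasure_eq_measure2 fin; simp add: bounded_diff)+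
      have mY: "measure lborel Y = measure lborel B" using Y(3) by (simp add: measure_def)
      have "energy J A B \<le> energy J (ball 0 \<alpha>) (ball 0 \<beta>) + ennreal (J 0) *
          (ennreal (D \<alpha> X) * ennreal (measure lborel B) + ennreal (measure lborel (ball (0::'a) \<alpha>)) * ennreal (D \<beta> Y))"
        using order_trans [OF E energy_le_energy_plus_measure [OF X(1) Y(1) _ _ J_meas J, of "ball 0 \<alpha>" "ball 0 \<beta>"]]
        unfolding eq mY by simp
      also have "\<dots> = energy J (ball 0 \<alpha>) (ball 0 \<beta>) +
           ennreal (J 0 * (D \<alpha> X * measure lborel B + measure lborel (ball (0::'a) \<alpha>) * D \<beta> Y))"
        using J0 by (simp add: D_def ennreal_mult ennreal_plus)
      also have "J 0 * (D \<alpha> X * measure lborel B + measure lborel (ball (0::'a) \<alpha>) * D \<beta> Y)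
                 \<le> J 0 * (d (X, Y) * measure lborel B + measure lborel (ball (0::'a) \<alpha>) * d (X, Y))"
        using J0 by (intro mult_left_mono add_mono mult_right_mono) (auto simp: d_def D_def)
      also have "\<dots> = K * d (X, Y)" by (simp add: K_def algebra_simps)
      also have "\<dots> \<le> K * (e / (K + 1))" using XY(2) K by (intro mult_left_mono) auto
      also have "\<dots> \<le> e" using K e by (simp add: field_simps)
      finally show "energy J A B \<le> energy J (ball 0 \<alpha>) (ball 0 \<beta>) + ennreal e"
        by (simp add: add_left_mono ennreal_leI)
    qed
  qed
qed

subsection \<open>Rearrangements of functions\<close>

text \<open>Each real factor r is the length of [0, r), with \<open>ennreal\<close> sending negative
  r to 0, and Fubini moves both level integrals outside. The weight \<open>k\<close> stays
  untouched, so the formula covers a kernel on a product space as well as single integrals.\<close>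

lemma nn_integral_layer_cake:
  assumes "sigma_finite_measure M" and [measurable]: "f \<in> borel_measurable M" "g \<in> borel_measurable M" "k \<in> borel_measurable M"
  shows "(\<integral>\<^sup>+x. ennreal (f x) * ennreal (g x) * k x \<partial>M) =
    (\<integral>\<^sup>+s. \<integral>\<^sup>+t. indicator {0..} s * indicator {0..} t *
      (\<integral>\<^sup>+x. indicator {x. s < f x} x * indicator {x. t < g x} x * k x \<partial>M) \<partial>lborel \<partial>lborel)"
proof -
  interpret M: sigma_finite_measure M by fact
  interpret P: pair_sigma_finite M "lborel :: real measure" ..
  let ?i = "\<lambda>s x. indicator {0..} s * (if s < x then 1 else 0) :: ennreal"
  have cake: "ennreal r = (\<integral>\<^sup>+s. ?i s r \<partial>lborel)" for r :: real
  proof -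
    have "(\<integral>\<^sup>+s. ?i s r \<partial>lborel) = (\<integral>\<^sup>+s. indicator {0..<r} s \<partial>lborel)"
      by (intro nn_integral_cong) (auto simp: indicator_def)
    also have "\<dots> = ennreal r"
      by (cases "0 \<le> r") (simp_all add: ennreal_neg)
    finally show ?thesis ..
  qed
  have cake2: "ennreal a * ennreal b * c = (\<integral>\<^sup>+s. \<integral>\<^sup>+t. ?i s a * (?i t b * c) \<partial>lborel \<partial>lborel)" for a b c
  proof -
    have "(\<integral>\<^sup>+s. \<integral>\<^sup>+t. ?i s a * (?i t b * c) \<partial>lborel \<partial>lborel) = (\<integral>\<^sup>+s. ?i s a * (\<integral>\<^sup>+t. ?i t b * c \<partial>lborel) \<partial>lborel)"
      by (intro nn_integral_cong nn_integral_cmult) measurable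
    also have "\<dots> = (\<integral>\<^sup>+s. ?i s a \<partial>lborel) * (\<integral>\<^sup>+t. ?i t b * c \<partial>lborel)"
      by (rule nn_integral_multc) measurable
    also have "(\<integral>\<^sup>+t. ?i t b * c \<partial>lborel) = (\<integral>\<^sup>+t. ?i t b \<partial>lborel) * c"
      by (rule nn_integral_multc) measurable
    finally show ?thesis by (simp only: cake mult.assoc)
  qed
  have "(\<integral>\<^sup>+x. ennreal (f x) * ennreal (g x) * k x \<partial>M) =
        (\<integral>\<^sup>+x. \<integral>\<^sup>+s. \<integral>\<^sup>+t. ?i s (f x) * (?i t (g x) * k x) \<partial>lborel \<partial>lborel \<partial>M)"
    by (simp only: cake2)
  also have "\<dots> = (\<integral>\<^sup>+s. \<integral>\<^sup>+x. \<integral>\<^sup>+t. ?i s (f x) * (?i t (g x) * k x) \<partial>lborel \<partial>M \<partial>lborel)"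
    by (rule P.Fubini' [symmetric]) measurable
  also have "\<dots> = (\<integral>\<^sup>+s. \<integral>\<^sup>+t. \<integral>\<^sup>+x. ?i s (f x) * (?i t (g x) * k x) \<partial>M \<partial>lborel \<partial>lborel)"
    by (intro nn_integral_cong P.Fubini' [symmetric]) measurable
  also have "\<dots> = (\<integral>\<^sup>+s. \<integral>\<^sup>+t. indicator {0..} s * indicator {0..} t *
      (\<integral>\<^sup>+x. indicator {x. s < f x} x * indicator {x. t < g x} x * k x \<partial>M) \<partial>lborel \<partial>lborel)"
  proof (intro nn_integral_cong)
    fix s t :: real
    have "(\<integral>\<^sup>+x. ?i s (f x) * (?i t (g x) * k x) \<partial>M) =
      (\<integral>\<^sup>+x. (indicator {0..} s * indicator {0..} t) * (indicator {x. s < f x} x * indicator {x. t < g x} x * k x) \<partial>M)"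
      by (intro nn_integral_cong) (auto simp: indicator_def)
    also have "\<dots> = indicator {0..} s * indicator {0..} t *
      (\<integral>\<^sup>+x. indicator {x. s < f x} x * indicator {x. t < g x} x * k x \<partial>M)"
      unfolding indicator_def by (rule nn_integral_cmult) measurable
    finally show "(\<integral>\<^sup>+x. ?i s (f x) * (?i t (g x) * k x) \<partial>M) = \<dots>" .
  qed
  finally show ?thesis .
qed

text \<open>The common reduction to level sets for Riesz' inequality, the equality of the L^2 norms
  and the Hardy--Littlewood inequality.\<close>

lemma nn_integral_mult_mono_superlevel:
  assumes "sigma_finite_measure M" and "f \<in> borel_measurable M" "g \<in> borel_measurable M" "k \<in> borel_measurable M"
    and "sigma_finite_measure N" and "f' \<in> borel_measurable N" "g' \<in> borel_measurable N" "k' \<in> borel_measurable N"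
    and le: "\<And>s t. 0 \<le> s \<Longrightarrow> 0 \<le> t \<Longrightarrow>
      (\<integral>\<^sup>+x. indicator {x. s < f x} x * indicator {x. t < g x} x * k x \<partial>M) \<le>
      (\<integral>\<^sup>+x. indicator {x. s < f' x} x * indicator {x. t < g' x} x * k' x \<partial>N)"
  shows "(\<integral>\<^sup>+x. ennreal (f x) * ennreal (g x) * k x \<partial>M) \<le> (\<integral>\<^sup>+x. ennreal (f' x) * ennreal (g' x) * k' x \<partial>N)"
  unfolding nn_integral_layer_cake [OF assms(1-4)] nn_integral_layer_cake [OF assms(5-8)]
  by (intro nn_integral_mono) (simp add: le split: split_indicator)

text \<open>The set is an interval starting at 0, so its length is its right end. Right continuity,
  in the form \<open>right\<close>, keeps this end out of the set, whence strict inequalities on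
  both sides; \<open>bounded\<close> excludes the junk value of an infinite measure.\<close>

lemma measure_superlevel_gt_iff:
  fixes d :: "real \<Rightarrow> real"
  assumes mono: "\<And>s t. 0 \<le> s \<Longrightarrow> s \<le> t \<Longrightarrow> d t \<le> d s"
    and right: "\<And>s. 0 \<le> s \<Longrightarrow> c < d s \<Longrightarrow> \<exists>t>s. c < d t"
    and bounded: "\<exists>t\<ge>0. d t \<le> c" and "0 \<le> s"
  shows "s < measure lebesgue {t. 0 \<le> t \<and> c < d t} \<longleftrightarrow> c < d s"
proof -
  define X where "X = {t. 0 \<le> t \<and> c < d t}"
  have sub: "X \<subseteq> {0..t}" if "0 \<le> t" "d t \<le> c" for t
  proof
    fix u assume "u \<in> X"
    then show "u \<in> {0..t}" using mono [of t u] that by (cases "u \<le> t") (auto simp: X_def)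
  qed
  obtain T where "0 \<le> T" "d T \<le> c" using bounded by auto
  then have "bounded X" using sub bounded_subset bounded_closed_interval by metis
  moreover have "convex X"
    unfolding is_interval_convex_1 [symmetric] is_interval_1 X_def using mono by (auto intro: less_le_trans)
  ultimately have X: "X \<in> lmeasurable" by (intro measurable_convex)
  show ?thesis
    unfolding X_def [symmetric]
  proof
    assume "c < d s"
    then obtain t where t: "s < t" "c < d t" using right \<open>0 \<le> s\<close> by blast
    have "{0..t} \<subseteq> X" using mono t by (auto simp: X_def intro: less_le_trans)
    then have "measure lebesgue {0..t} \<le> measure lebesgue X"
      using X by (intro measure_mono_fmeasurable) auto
    then show "s < measure lebesgue X" using t \<open>0 \<le> s\<close> by simp
  next
    assume s: "s < measure lebesgue X"
    show "c < d s"
    proof (rule ccontr)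
      assume "\<not> c < d s"
      then have "X \<subseteq> {0..s}" using sub \<open>0 \<le> s\<close> by simp
      then have "measure lebesgue X \<le> measure lebesgue {0..s}"
        using X by (intro measure_mono_fmeasurable) (auto simp: fmeasurableD)
      then show False using s \<open>0 \<le> s\<close> by simp
    qed
  qed
qed

text \<open>The rearrangement is the generalized inverse of the distribution function, which is
  right continuous by continuity of measure from below and tends to 0 by continuity from above. The
  latter bounds the measured set for \<open>0 < c\<close>; at c = 0 an unbounded \<open>u\<close>
  may make it infinite.\<close>

lemma decreasing_rearrangement_gt_iff:
  fixes u :: "'a::euclidean_space \<Rightarrow> real"
  assumes S: "S \<in> lmeasurable" and u: "\<And>t. {x \<in> S. t < \<bar>u x\<bar>} \<in> sets lebesgue"
    and "0 < c" "0 \<le> s"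
  shows "s < decreasing_rearrangement S u c \<longleftrightarrow> c < distribution_fun S u s"
  unfolding decreasing_rearrangement_def
proof (rule measure_superlevel_gt_iff)
  let ?L = "\<lambda>t. {x \<in> S. t < \<bar>u x\<bar>}"
  have L: "?L t \<in> lmeasurable" for t
    by (rule fmeasurableI2 [OF S]) (use u in auto)
  show "distribution_fun S u t \<le> distribution_fun S u s" if "s \<le> t" for s t
    unfolding distribution_fun_def using that L by (intro measure_mono_fmeasurable) (auto simp: fmeasurableD)
  show "\<exists>t>s. c < distribution_fun S u t" if "c < distribution_fun S u s" for s
  proof -
    let ?A = "\<lambda>i. ?L (s + inverse (real (Suc i)))"
    have "?L s = (\<Union>i. ?A i)"
    proof (intro equalityI subsetI)
      fix x assume "x \<in> ?L s"
      then obtain i where "inverse (real (Suc i)) < \<bar>u x\<bar> - s" using reals_Archimedean [of "\<bar>u x\<bar> - s"] by auto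
      then show "x \<in> (\<Union>i. ?A i)" using \<open>x \<in> ?L s\<close> by (auto intro!: exI [of _ i])
    qed (auto intro: less_trans [rotated] simp: add_pos_pos)
    moreover have "(\<lambda>i. measure lebesgue (?A i)) \<longlonglongrightarrow> measure lebesgue (\<Union>i. ?A i)"
    proof (rule Lim_measure_incseq)
      show "incseq ?A"
        unfolding incseq_def
      proof (intro allI impI subsetI)
        fix i j :: nat and x assume "i \<le> j" and x: "x \<in> ?A i"
        then have "s + inverse (real (Suc j)) \<le> s + inverse (real (Suc i))"
          by (intro add_left_mono le_imp_inverse_le) auto
        then show "x \<in> ?A j" using x by (blast intro: le_less_trans)
      qed
      have "(\<Union>i. ?A i) \<in> lmeasurable" using calculation L [of s] by simp
      then show "emeasure lebesgue (\<Union>i. ?A i) \<noteq> \<infinity>" by (simp only: fmeasurableD2 infinity_ennreal_def not_False_eq_True)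
    qed (use u in auto)
    ultimately have "\<forall>\<^sub>F i in sequentially. c < measure lebesgue (?A i)"
      using that by (intro order_tendstoD) (auto simp: distribution_fun_def)
    then obtain i where "c < measure lebesgue (?A i)" by (auto dest: eventually_happens)
    then show ?thesis
      by (intro exI [of _ "s + inverse (real (Suc i))"]) (auto simp: distribution_fun_def)
  qed
  show "\<exists>t\<ge>0. distribution_fun S u t \<le> c"
  proof -
    let ?A = "\<lambda>i. ?L (real i)"
    have "(\<lambda>i. measure lebesgue (?A i)) \<longlonglongrightarrow> measure lebesgue (\<Inter>i. ?A i)"
    proof (rule Lim_measure_decseq)
      show "decseq ?A"
        unfolding decseq_def
      proof (intro allI impI subsetI)
        fix i j :: nat and x assume "i \<le> j" and x: "x \<in> ?A j"
        then have "real i \<le> real j" by simp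
        then show "x \<in> ?A i" using x by auto
      qed
      show "emeasure lebesgue (?A i) \<noteq> \<infinity>" for i using fmeasurableD2 [OF L] by simp
    qed (use u in auto)
    moreover have "(\<Inter>i. ?A i) = {}"
    proof (intro equals0I)
      fix x assume x: "x \<in> (\<Inter>i. ?A i)"
      obtain i where "\<bar>u x\<bar> \<le> real i" using real_arch_simple by blast
      moreover have "x \<in> ?A i" using x by blast
      ultimately show False by simp
    qed
    ultimately have "\<forall>\<^sub>F i in sequentially. measure lebesgue (?A i) < c"
      using \<open>0 < c\<close> by (intro order_tendstoD) auto
    then obtain i where "measure lebesgue (?A i) < c" by (auto dest: eventually_happens)
    then show ?thesis
      by (intro exI [of _ "real i"]) (auto simp: distribution_fun_def)
  qed
qed (use assms in auto)

lemma ball_of_volume: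
  assumes "0 \<le> v"
  obtains \<rho> where "0 \<le> \<rho>" "unit_ball_vol (real DIM('a::euclidean_space)) * \<rho> ^ DIM('a) = v"
    "\<And>x :: 'a. unit_ball_vol (real DIM('a)) * norm x ^ DIM('a) < v \<longleftrightarrow> x \<in> ball 0 \<rho>"
    "\<And>x :: 'a. unit_ball_vol (real DIM('a)) * norm x ^ DIM('a) \<le> v \<longleftrightarrow> x \<in> cball 0 \<rho>"
    "emeasure lborel (ball (0::'a) \<rho>) = ennreal v" "emeasure lborel (cball (0::'a) \<rho>) = ennreal v"
proof -
  let ?\<omega> = "unit_ball_vol (real DIM('a))"
  define \<rho> where "\<rho> = root DIM('a) (v / ?\<omega>)"
  have \<omega>: "0 < ?\<omega>" by simp
  have \<rho>: "0 \<le> \<rho>" using assms by (simp add: \<rho>_def)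
  have v: "?\<omega> * \<rho> ^ DIM('a) = v"
    unfolding \<rho>_def using assms less_imp_neq [OF \<omega>] by (subst real_root_pow_pos2) auto
  have "?\<omega> * norm x ^ DIM('a) < v \<longleftrightarrow> x \<in> ball 0 \<rho>" for x :: 'a
    unfolding v [symmetric] using \<omega> \<rho> power_mono_iff [OF \<rho> norm_ge_zero [of x], of "DIM('a)"]
    by (simp add: not_le [symmetric])
  moreover have "?\<omega> * norm x ^ DIM('a) \<le> v \<longleftrightarrow> x \<in> cball 0 \<rho>" for x :: 'a
    unfolding v [symmetric] using \<omega> \<rho> by (simp add: power_mono_iff)
  ultimately show ?thesis
    using \<rho> v emeasure_ball [OF \<rho>, of "0 :: 'a"] emeasure_cball [OF \<rho>, of "0 :: 'a"]
    by (intro that) auto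
qed

text \<open>
  At the origin the set measured by the rearrangement may be unbounded, and its real-valued measure
  then is the junk value \<open>0\<close>; the value there is fixed so that superlevel sets are punctured balls.
\<close>
definition symmetric_decreasing_rearrangement :: "'a::euclidean_space set \<Rightarrow> ('a \<Rightarrow> real) \<Rightarrow> 'a \<Rightarrow> real" where
  "symmetric_decreasing_rearrangement S u x =
     (if x = 0 then 0 else decreasing_rearrangement S u (unit_ball_vol (real DIM('a)) * norm x ^ DIM('a)))"

lemma symmetric_decreasing_rearrangement_nonneg: "0 \<le> symmetric_decreasing_rearrangement S u x"
  by (simp add: symmetric_decreasing_rearrangement_def decreasing_rearrangement_def)

lemma superlevel_symmetric_decreasing_rearrangement:
  fixes u :: "'a::euclidean_space \<Rightarrow> real"
  assumes S: "S \<in> lmeasurable" and u: "\<And>t. {x \<in> S. t < \<bar>u x\<bar>} \<in> sets lebesgue" and s: "0 \<le> s"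
  obtains \<rho> where "0 \<le> \<rho>" "emeasure lborel (ball (0::'a) \<rho>) = ennreal (distribution_fun S u s)"
    "{x. s < symmetric_decreasing_rearrangement S u x} = ball 0 \<rho> - {0}"
proof -
  let ?\<omega> = "unit_ball_vol (real DIM('a))"
  have "0 \<le> distribution_fun S u s" by (simp add: distribution_fun_def)
  then obtain \<rho> where \<rho>: "0 \<le> \<rho>" "\<And>x :: 'a. ?\<omega> * norm x ^ DIM('a) < distribution_fun S u s \<longleftrightarrow> x \<in> ball 0 \<rho>"
      "emeasure lborel (ball (0::'a) \<rho>) = ennreal (distribution_fun S u s)"
    by (rule ball_of_volume) blast
  have "s < symmetric_decreasing_rearrangement S u x \<longleftrightarrow> x \<in> ball 0 \<rho> - {0}" for x
    using decreasing_rearrangement_gt_iff [OF S u, of "?\<omega> * norm x ^ DIM('a)" s] s \<rho>(2) [of x]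
    by (simp add: symmetric_decreasing_rearrangement_def)
  then show ?thesis by (intro that [OF \<rho>(1) \<rho>(3)]) blast
qed

lemma symmetric_decreasing_rearrangement_borel:
  fixes u :: "'a::euclidean_space \<Rightarrow> real"
  assumes S: "S \<in> lmeasurable" and u: "\<And>t. {x \<in> S. t < \<bar>u x\<bar>} \<in> sets lebesgue"
  shows "symmetric_decreasing_rearrangement S u \<in> borel_measurable borel"
  unfolding borel_measurable_iff_greater
proof
  fix s
  show "{w \<in> space borel. s < symmetric_decreasing_rearrangement S u w} \<in> sets borel"
  proof (cases "0 \<le> s")
    case True
    then obtain \<rho> where "{x. s < symmetric_decreasing_rearrangement S u x} = ball 0 \<rho> - {0}"
      using superlevel_symmetric_decreasing_rearrangement [OF S u] by metis
    then show ?thesis by simp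
  next
    case False
    then have "s < symmetric_decreasing_rearrangement S u x" for x
      using symmetric_decreasing_rearrangement_nonneg [of S u x] by linarith
    then show ?thesis by simp
  qed
qed

section \<open>Equimeasurability and Riesz' inequality for functions\<close>

lemma emeasure_ball_minus_origin: "emeasure lborel (ball 0 \<rho> - {0 :: 'a}) = emeasure lborel (ball (0::'a::euclidean_space) \<rho>)"
  by (intro emeasure_Diff_null_set) auto

lemma energy_ball_minus_origin:
  assumes [measurable]: "J \<in> borel_measurable borel"
  shows "energy J (ball 0 \<alpha> - {0}) (ball 0 \<beta> - {0}) = energy J (ball 0 \<alpha>) (ball (0::'a::euclidean_space) \<beta>)"
proof -
  have ae: "AE x in lborel. x \<noteq> (0::'a)" by (rule AE_lborel_singleton)
  have "(\<integral>\<^sup>+y. indicator (ball 0 \<alpha> - {0}) x * indicator (ball 0 \<beta> - {0}) y * ennreal (J (x - y)) \<partial>lborel)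
      = (\<integral>\<^sup>+y. indicator (ball 0 \<alpha>) x * indicator (ball 0 \<beta>) y * ennreal (J (x - y)) \<partial>lborel)"
    if "x \<noteq> (0::'a)" for x
    using that by (intro nn_integral_cong_AE eventually_mono [OF ae]) (simp add: indicator_def)
  from nn_integral_cong_AE [OF eventually_mono [OF ae this]] show ?thesis
    unfolding energy_def by assumption
qed

lemma distribution_fun_eq_emeasure:
  fixes f :: "'a::euclidean_space \<Rightarrow> real"
  assumes S: "S \<in> lmeasurable" and [measurable]: "f \<in> borel_measurable borel"
    and f: "\<And>x. 0 \<le> f x" "\<And>x. x \<notin> S \<Longrightarrow> f x = 0" and s: "0 \<le> s"
  shows "ennreal (distribution_fun S f s) = emeasure lborel {x. s < f x}"
proof -
  have eq: "{x \<in> S. s < \<bar>f x\<bar>} = {x. s < f x}" using f s by (auto simp: not_less) (metis not_less)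
  have borel: "{x. s < f x} \<in> sets borel" by measurable
  then have "{x. s < f x} \<in> lmeasurable"
    using f s by (intro fmeasurableI2 [OF S]) (auto simp: not_less, metis not_less)
  then have "emeasure lebesgue {x. s < f x} = ennreal (measure lebesgue {x. s < f x})"
    by (rule emeasure_eq_measure2)
  then show ?thesis
    using borel unfolding distribution_fun_def eq by simp
qed

lemma superlevel_sets_lebesgue:
  fixes f :: "'a::euclidean_space \<Rightarrow> real"
  assumes S: "S \<in> lmeasurable" and [measurable]: "f \<in> borel_measurable borel"
  shows "{x \<in> S. t < \<bar>f x\<bar>} \<in> sets lebesgue"
proof -
  have "{x. t < \<bar>f x\<bar>} \<in> sets borel" by measurable
  then have "S \<inter> {x. t < \<bar>f x\<bar>} \<in> sets lebesgue" using S by auto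
  then show ?thesis by (simp add: Int_def)
qed

lemma superlevel_symmetric_decreasing_rearrangement':
  fixes f :: "'a::euclidean_space \<Rightarrow> real"
  assumes S: "S \<in> lmeasurable" and f_meas [measurable]: "f \<in> borel_measurable borel"
    and f: "\<And>x. 0 \<le> f x" "\<And>x. x \<notin> S \<Longrightarrow> f x = 0" and s: "0 \<le> s"
  obtains \<rho> where "0 \<le> \<rho>" "emeasure lborel (ball (0::'a) \<rho>) = emeasure lborel {x. s < f x}"
    "{x. s < symmetric_decreasing_rearrangement S f x} = ball 0 \<rho> - {0}"
  using superlevel_symmetric_decreasing_rearrangement [OF S superlevel_sets_lebesgue [OF S f_meas] s] that
    distribution_fun_eq_emeasure [OF assms] by metis

text \<open>Layer cake on the product space: the factors are f(x) and f(y) as functions of the pair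
  and the weight is the kernel, so two level sets of \<open>f\<close> appear with independent levels
  and the set inequality applies to them.\<close>

theorem energy_le_energy_rearrangement:
  fixes f J :: "'a::euclidean_space \<Rightarrow> real"
  assumes S: "S \<in> lmeasurable" "S \<subseteq> cball 0 R" and f_meas [measurable]: "f \<in> borel_measurable borel"
    and f: "\<And>x. 0 \<le> f x" "\<And>x. x \<notin> S \<Longrightarrow> f x = 0"
    and J_meas [measurable]: "J \<in> borel_measurable borel" and J: "\<And>x y. norm x \<le> norm y \<Longrightarrow> J y \<le> J x"
  defines "g \<equiv> symmetric_decreasing_rearrangement S f"
  shows "(\<integral>\<^sup>+x. \<integral>\<^sup>+y. ennreal (f x) * ennreal (f y) * ennreal (J (x - y)) \<partial>lborel \<partial>lborel) \<le>
         (\<integral>\<^sup>+x. \<integral>\<^sup>+y. ennreal (g x) * ennreal (g y) * ennreal (J (x - y)) \<partial>lborel \<partial>lborel)"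
proof -
  have [measurable]: "g \<in> borel_measurable borel"
    unfolding g_def by (rule symmetric_decreasing_rearrangement_borel [OF S(1) superlevel_sets_lebesgue [OF S(1) f_meas]])
  let ?M = "lborel \<Otimes>\<^sub>M lborel :: ('a \<times> 'a) measure"
  have energy: "energy J {x. s < h x} {x. t < h x} =
      (\<integral>\<^sup>+z. indicator {z. s < h (fst z)} z * indicator {z. t < h (snd z)} z * ennreal (J (fst z - snd z)) \<partial>?M)"
    if [measurable]: "h \<in> borel_measurable borel" for h and s t :: real
  proof -
    have "energy J {x. s < h x} {x. t < h x} =
        (\<integral>\<^sup>+x. \<integral>\<^sup>+y. (\<lambda>z. indicator {x. s < h x} (fst z) * indicator {x. t < h x} (snd z) * ennreal (J (fst z - snd z))) (x, y) \<partial>lborel \<partial>lborel)"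
      by (simp add: energy_def)
    also have "\<dots> = (\<integral>\<^sup>+z. indicator {x. s < h x} (fst z) * indicator {x. t < h x} (snd z) * ennreal (J (fst z - snd z)) \<partial>?M)"
      by (rule lborel.nn_integral_fst) measurable
    finally show ?thesis by (simp add: indicator_def)
  qed
  have prod: "(\<integral>\<^sup>+x. \<integral>\<^sup>+y. ennreal (h x) * ennreal (h y) * ennreal (J (x - y)) \<partial>lborel \<partial>lborel) =
      (\<integral>\<^sup>+z. ennreal (h (fst z)) * ennreal (h (snd z)) * ennreal (J (fst z - snd z)) \<partial>?M)"
    if [measurable]: "h \<in> borel_measurable borel" for h
    using lborel.nn_integral_fst [of "\<lambda>z. ennreal (h (fst z)) * ennreal (h (snd z)) * ennreal (J (fst z - snd z))" lborel]
    by simp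
  have "(\<integral>\<^sup>+z. ennreal (f (fst z)) * ennreal (f (snd z)) * ennreal (J (fst z - snd z)) \<partial>?M) \<le>
        (\<integral>\<^sup>+z. ennreal (g (fst z)) * ennreal (g (snd z)) * ennreal (J (fst z - snd z)) \<partial>?M)"
  proof (rule nn_integral_mult_mono_superlevel)
    show "sigma_finite_measure ?M" "sigma_finite_measure ?M" by (rule lborel_pair.sigma_finite_measure_axioms)+
    fix s t :: real assume st: "0 \<le> s" "0 \<le> t"
    obtain \<alpha> where \<alpha>: "emeasure lborel (ball (0::'a) \<alpha>) = emeasure lborel {x. s < f x}" "{x. s < g x} = ball 0 \<alpha> - {0}"
      using superlevel_symmetric_decreasing_rearrangement' [OF S(1) f_meas f st(1)] unfolding g_def by metis
    obtain \<beta> where \<beta>: "emeasure lborel (ball (0::'a) \<beta>) = emeasure lborel {x. t < f x}" "{x. t < g x} = ball 0 \<beta> - {0}"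
      using superlevel_symmetric_decreasing_rearrangement' [OF S(1) f_meas f st(2)] unfolding g_def by metis
    have sub: "{x. u < f x} \<subseteq> cball 0 R" if "0 \<le> u" for u
      using S(2) f(2) that by (force simp: subset_eq)
    have "energy J {x. s < f x} {x. t < f x} \<le> energy J (ball 0 \<alpha>) (ball 0 \<beta>)"
      using \<alpha>(1) \<beta>(1) st by (intro energy_le_energy_ball [OF _ sub _ _ sub] J) auto
    also have "\<dots> = energy J {x. s < g x} {x. t < g x}"
      by (simp only: \<alpha>(2) \<beta>(2) energy_ball_minus_origin [OF J_meas])
    finally show "(\<integral>\<^sup>+z. indicator {z. s < f (fst z)} z * indicator {z. t < f (snd z)} z * ennreal (J (fst z - snd z)) \<partial>?M)
      \<le> (\<integral>\<^sup>+z. indicator {z. s < g (fst z)} z * indicator {z. t < g (snd z)} z * ennreal (J (fst z - snd z)) \<partial>?M)"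
      by (simp add: energy)
  qed measurable
  then show ?thesis by (simp add: prod)
qed

lemma nn_integral_square_rearrangement:
  fixes f :: "'a::euclidean_space \<Rightarrow> real"
  assumes S: "S \<in> lmeasurable" and f_meas [measurable]: "f \<in> borel_measurable borel"
    and f: "\<And>x. 0 \<le> f x" "\<And>x. x \<notin> S \<Longrightarrow> f x = 0"
  defines "g \<equiv> symmetric_decreasing_rearrangement S f"
  shows "(\<integral>\<^sup>+x. ennreal (g x) * ennreal (g x) \<partial>lborel) = (\<integral>\<^sup>+x. ennreal (f x) * ennreal (f x) \<partial>lborel)"
proof -
  have [measurable]: "g \<in> borel_measurable borel"
    unfolding g_def by (rule symmetric_decreasing_rearrangement_borel [OF S superlevel_sets_lebesgue [OF S f_meas]])
  have eq: "(\<integral>\<^sup>+x. indicator {x. s < h x} x * indicator {x. t < h x} x * 1 \<partial>lborel) = emeasure lborel {x. max s t < h x}"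
    if [measurable]: "h \<in> borel_measurable borel" for h :: "'a \<Rightarrow> real" and s t :: real
  proof -
    have "(\<integral>\<^sup>+x. indicator {x. s < h x} x * indicator {x. t < h x} x * 1 \<partial>lborel) = (\<integral>\<^sup>+x. indicator {x. max s t < h x} x \<partial>lborel)"
      by (intro nn_integral_cong) (auto simp: indicator_def)
    then show ?thesis by simp
  qed
  have level: "emeasure lborel {x. s < g x} = emeasure lborel {x. s < f x}" if "0 \<le> s" for s
    using superlevel_symmetric_decreasing_rearrangement' [OF S f_meas f that] unfolding g_def
    by (metis emeasure_ball_minus_origin)
  \<comment> \<open>The reduction to level sets yields only inequalities, so it is carried out for
    any two equimeasurable functions and used in both directions.\<close>
  have le: "(\<integral>\<^sup>+x. ennreal (h1 x) * ennreal (h1 x) * 1 \<partial>lborel) \<le> (\<integral>\<^sup>+x. ennreal (h2 x) * ennreal (h2 x) * 1 \<partial>lborel)"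
    if h: "h1 \<in> borel_measurable borel" "h2 \<in> borel_measurable borel"
      and level: "\<And>s. 0 \<le> s \<Longrightarrow> emeasure lborel {x. s < h1 x} = emeasure lborel {x. s < h2 x}" for h1 h2 :: "'a \<Rightarrow> real"
  proof (rule nn_integral_mult_mono_superlevel)
    fix s t :: real assume "0 \<le> s" "0 \<le> t"
    then show "(\<integral>\<^sup>+x. indicator {x. s < h1 x} x * indicator {x. t < h1 x} x * 1 \<partial>lborel) \<le>
               (\<integral>\<^sup>+x. indicator {x. s < h2 x} x * indicator {x. t < h2 x} x * 1 \<partial>lborel)"
      unfolding eq [OF h(1)] eq [OF h(2)] using level [of "max s t"] by simp
  qed (use h lborel.sigma_finite_measure_axioms in auto)
  have "(\<integral>\<^sup>+x. ennreal (g x) * ennreal (g x) * 1 \<partial>lborel) = (\<integral>\<^sup>+x. ennreal (f x) * ennreal (f x) * 1 \<partial>lborel)"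
    by (intro antisym le level level [symmetric]) auto
  then show ?thesis by simp
qed

section \<open>Hardy--Littlewood inequality for an increasing and a decreasing rearrangement\<close>

text \<open>Inclusion and exclusion: |A \<inter> B| \<ge> |A| + |B| - |S|, and the annulus, unless
  empty, has exactly the volume on the right. Its outer ball is the decreasing rearrangement of
  \<open>B\<close>; its hole has the volume of the complement of \<open>A\<close> in
  \<open>S\<close>.\<close>

lemma emeasure_annulus_le:
  fixes A B S :: "'a::euclidean_space set"
  assumes S: "S \<in> fmeasurable lborel" and AB: "A \<in> sets borel" "B \<in> sets borel" "A \<subseteq> S" "B \<subseteq> S"
    and \<rho>: "0 \<le> \<rho>" "emeasure lborel (cball (0::'a) \<rho>) = ennreal (measure lborel S - measure lborel A)"
    and \<sigma>: "emeasure lborel (ball (0::'a) \<sigma>) = emeasure lborel B"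
  shows "emeasure lborel (ball (0::'a) \<sigma> - cball 0 \<rho>) \<le> emeasure lborel (A \<inter> B)"
proof (cases "\<sigma> \<le> \<rho>")
  case True
  then have "ball (0::'a) \<sigma> - cball 0 \<rho> = {}" by auto
  then show ?thesis by (simp only: emeasure_empty zero_le)
next
  case False
  have fin: "X \<in> fmeasurable lborel" if "X \<in> sets borel" "X \<subseteq> S" for X
    using that by (intro fmeasurableI2 [OF S]) auto
  have le: "measure lborel A \<le> measure lborel S"
    using S AB by (intro measure_mono_fmeasurable) auto
  have "emeasure lborel (ball (0::'a) \<sigma> - cball 0 \<rho>) = emeasure lborel (ball (0::'a) \<sigma>) - emeasure lborel (cball (0::'a) \<rho>)"
    using False \<rho> by (intro emeasure_Diff) auto
  also have "\<dots> = ennreal (measure lborel B - (measure lborel S - measure lborel A))"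
    unfolding \<sigma> \<rho>(2) emeasure_eq_measure2 [OF fin [OF AB(2,4)]] using le by (simp add: ennreal_minus)
  also have "measure lborel B - (measure lborel S - measure lborel A) \<le> measure lborel (A \<inter> B)"
  proof -
    have "measure lborel (A \<union> B) \<le> measure lborel S"
      using S AB by (intro measure_mono_fmeasurable) auto
    then show ?thesis
      using measure_Un3 [OF fin [OF AB(1,3)] fin [OF AB(2,4)]] by simp
  qed
  then have "ennreal (measure lborel B - (measure lborel S - measure lborel A)) \<le> ennreal (measure lborel (A \<inter> B))"
    by (rule ennreal_leI)
  also have "\<dots> = emeasure lborel (A \<inter> B)"
    using AB by (intro emeasure_eq_measure2 [symmetric] fin) auto
  finally show ?thesis .
qed

lemma superlevel_symmetric_increasing_rearrangement:
  fixes a :: "'a::euclidean_space \<Rightarrow> real"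
  assumes S: "S \<in> lmeasurable" and a: "\<And>t. {x \<in> S. t < \<bar>a x\<bar>} \<in> sets lebesgue" and s: "0 \<le> s"
    and vol: "unit_ball_vol (real DIM('a)) * r ^ DIM('a) = measure lebesgue S" and r: "0 \<le> r"
  obtains \<rho> where "0 \<le> \<rho>" "emeasure lborel (cball (0::'a) \<rho>) = ennreal (measure lebesgue S - distribution_fun S a s)"
    "{x \<in> ball 0 r. s < symmetric_increasing_rearrangement S a x} = ball 0 r - cball 0 \<rho>"
proof -
  let ?\<omega> = "unit_ball_vol (real DIM('a))"
  have "distribution_fun S a s \<le> measure lebesgue S"
    unfolding distribution_fun_def using S a by (intro measure_mono_fmeasurable) auto
  then have "0 \<le> measure lebesgue S - distribution_fun S a s" by simp
  then obtain \<rho> where \<rho>: "0 \<le> \<rho>" "\<And>x :: 'a. ?\<omega> * norm x ^ DIM('a) \<le> measure lebesgue S - distribution_fun S a s \<longleftrightarrow> x \<in> cball 0 \<rho>"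
      "emeasure lborel (cball (0::'a) \<rho>) = ennreal (measure lebesgue S - distribution_fun S a s)"
    by (rule ball_of_volume) blast
  have "s < symmetric_increasing_rearrangement S a x \<longleftrightarrow> x \<notin> cball 0 \<rho>" if "x \<in> ball 0 r" for x
  proof -
    \<comment> \<open>Inside the open ball the argument |S| - \<omega> |x|^n of the decreasing
      rearrangement is positive, as its characterization requires.\<close>
    have "norm x ^ DIM('a) < r ^ DIM('a)"
      using that by (intro power_strict_mono) auto
    then have "?\<omega> * norm x ^ DIM('a) < measure lebesgue S"
      unfolding vol [symmetric] by simp
    then show ?thesis
      using decreasing_rearrangement_gt_iff [OF S a, of "measure lebesgue S - ?\<omega> * norm x ^ DIM('a)" s] s \<rho>(2) [of x]
      unfolding symmetric_increasing_rearrangement_def increasing_rearrangement_def by auto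
  qed
  then show ?thesis by (intro that [OF \<rho>(1) \<rho>(3)]) blast
qed

lemma symmetric_increasing_rearrangement_nonneg: "0 \<le> symmetric_increasing_rearrangement S a x"
  by (simp add: symmetric_increasing_rearrangement_def increasing_rearrangement_def decreasing_rearrangement_def)

lemma symmetric_increasing_rearrangement_borel:
  fixes a :: "'a::euclidean_space \<Rightarrow> real"
  assumes S: "S \<in> lmeasurable" and a: "\<And>t. {x \<in> S. t < \<bar>a x\<bar>} \<in> sets lebesgue"
    and vol: "unit_ball_vol (real DIM('a)) * r ^ DIM('a) = measure lebesgue S" and r: "0 \<le> r"
  shows "(\<lambda>x. indicator (ball 0 r) x * symmetric_increasing_rearrangement S a x) \<in> borel_measurable borel" (is "?b \<in> _")
  unfolding borel_measurable_iff_greater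
proof
  fix s
  show "{w \<in> space borel. s < ?b w} \<in> sets borel"
  proof (cases "0 \<le> s")
    case True
    then obtain \<rho> where \<rho>: "{x \<in> ball 0 r. s < symmetric_increasing_rearrangement S a x} = ball 0 r - cball 0 \<rho>"
      using superlevel_symmetric_increasing_rearrangement [OF S a _ vol r] by metis
    have "{w \<in> space borel. s < ?b w} = {x \<in> ball 0 r. s < symmetric_increasing_rearrangement S a x}"
      using True by (auto simp: indicator_def)
    then show ?thesis unfolding \<rho> by simp
  next
    case False
    then have "s < ?b x" for x
      using symmetric_increasing_rearrangement_nonneg [of S a x] by (simp add: indicator_def)
    then show ?thesis by simp
  qed
qed

text \<open>An increasing function is paired with a decreasing one, so their level sets overlap as
  little as their volumes permit; hence the direction opposite to the usual inequality for two
  decreasing rearrangements.\<close>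

theorem nn_integral_increasing_decreasing_rearrangement_le:
  fixes f a :: "'a::euclidean_space \<Rightarrow> real"
  assumes S: "S \<in> lmeasurable" "S \<in> sets borel" and f_meas [measurable]: "f \<in> borel_measurable borel"
    and f: "\<And>x. 0 \<le> f x" "\<And>x. x \<notin> S \<Longrightarrow> f x = 0"
    and a_meas: "(\<lambda>x. indicator S x * a x) \<in> borel_measurable borel" and a: "\<And>x. x \<in> S \<Longrightarrow> 0 \<le> a x"
    and vol: "unit_ball_vol (real DIM('a)) * r ^ DIM('a) = measure lebesgue S" and r: "0 \<le> r"
  defines "g \<equiv> symmetric_decreasing_rearrangement S f"
    and "b \<equiv> \<lambda>x. indicator (ball 0 r) x * symmetric_increasing_rearrangement S a x"
  shows "(\<integral>\<^sup>+x. ennreal (b x) * ennreal ((g x)\<^sup>2) \<partial>lborel) \<le>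
         (\<integral>\<^sup>+x. ennreal (indicator S x * a x) * ennreal ((f x)\<^sup>2) \<partial>lborel)"
proof -
  let ?a = "\<lambda>x. indicator S x * a x"
  note [measurable] = a_meas
  have a_lev: "{x \<in> S. t < \<bar>a x\<bar>} \<in> sets borel" for t
  proof -
    have "{x \<in> S. t < \<bar>?a x\<bar>} \<in> sets borel" using S(2) by measurable
    moreover have "{x \<in> S. t < \<bar>?a x\<bar>} = {x \<in> S. t < \<bar>a x\<bar>}" by auto
    ultimately show ?thesis by simp
  qed
  then have a_lev': "{x \<in> S. t < \<bar>a x\<bar>} \<in> sets lebesgue" for t by simp
  have [measurable]: "g \<in> borel_measurable borel"
    unfolding g_def by (rule symmetric_decreasing_rearrangement_borel [OF S(1) superlevel_sets_lebesgue [OF S(1) f_meas]])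
  have [measurable]: "b \<in> borel_measurable borel"
    unfolding b_def by (rule symmetric_increasing_rearrangement_borel [OF S(1) a_lev' vol r])
  have S': "S \<in> fmeasurable lborel" using S
    by (intro fmeasurableI) (auto simp: fmeasurable_def)
  \<comment> \<open>The square is not rearranged itself: level t of the square is level
    \<open>sqrt t\<close> of the function, before and after rearrangement.\<close>
  have sqrt: "t < (h x)\<^sup>2 \<longleftrightarrow> sqrt t < h x" if "0 \<le> t" "0 \<le> h x" for t h and x :: 'a
    using that by (metis real_sqrt_less_iff real_sqrt_abs abs_of_nonneg)
  have "(\<integral>\<^sup>+x. ennreal (b x) * ennreal ((g x)\<^sup>2) * 1 \<partial>lborel) \<le>
        (\<integral>\<^sup>+x. ennreal (?a x) * ennreal ((f x)\<^sup>2) * 1 \<partial>lborel)"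
  proof (rule nn_integral_mult_mono_superlevel)
    fix s t :: real assume st: "0 \<le> s" "0 \<le> t"
    define A where "A = {x \<in> S. s < \<bar>a x\<bar>}"
    define B where "B = {x. sqrt t < f x}"
    have A: "A \<in> sets borel" "A \<subseteq> S" using a_lev by (auto simp: A_def)
    have B: "B \<in> sets borel" unfolding B_def by measurable
    have "B \<subseteq> S" using f(2) st by (force simp: B_def)
    obtain \<rho> where \<rho>: "0 \<le> \<rho>" "emeasure lborel (cball (0::'a) \<rho>) = ennreal (measure lebesgue S - distribution_fun S a s)"
      "{x \<in> ball 0 r. s < symmetric_increasing_rearrangement S a x} = ball 0 r - cball 0 \<rho>"
      by (rule superlevel_symmetric_increasing_rearrangement [OF S(1) a_lev' st(1) vol r])
    obtain \<sigma> where \<sigma>: "emeasure lborel (ball (0::'a) \<sigma>) = emeasure lborel B" "{x. sqrt t < g x} = ball 0 \<sigma> - {0}"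
      using superlevel_symmetric_decreasing_rearrangement' [OF S(1) f_meas f, of "sqrt t"] st unfolding g_def B_def by auto
    have dA: "measure lebesgue S - distribution_fun S a s = measure lborel S - measure lborel A"
      unfolding distribution_fun_def A_def [symmetric] using A S by simp
    have "(\<integral>\<^sup>+x. indicator {x. s < b x} x * indicator {x. t < (g x)\<^sup>2} x * 1 \<partial>lborel)
        = emeasure lborel ({x. s < b x} \<inter> {x. sqrt t < g x})"
    proof -
      have "(\<integral>\<^sup>+x. indicator {x. s < b x} x * indicator {x. t < (g x)\<^sup>2} x * 1 \<partial>lborel)
        = (\<integral>\<^sup>+x. indicator ({x. s < b x} \<inter> {x. sqrt t < g x}) x \<partial>lborel)"
        using sqrt [OF st(2), of g] symmetric_decreasing_rearrangement_nonneg [of S f]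
        by (intro nn_integral_cong) (auto simp: indicator_def g_def)
      then show ?thesis by simp
    qed
    also have "\<dots> \<le> emeasure lborel (ball (0::'a) \<sigma> - cball 0 \<rho>)"
    proof (intro emeasure_mono)
      have "{x. s < b x} \<subseteq> {x \<in> ball 0 r. s < symmetric_increasing_rearrangement S a x}"
        using st by (auto simp: b_def indicator_def split: if_splits)
      then show "{x. s < b x} \<inter> {x. sqrt t < g x} \<subseteq> ball 0 \<sigma> - cball 0 \<rho>"
        unfolding \<rho>(3) \<sigma>(2) by blast
    qed auto
    also have "\<dots> \<le> emeasure lborel (A \<inter> B)"
      using \<rho>(2) by (intro emeasure_annulus_le [OF S' A(1) B A(2) \<open>B \<subseteq> S\<close> \<rho>(1) _ \<sigma>(1)]) (simp add: dA)
    also have "\<dots> = (\<integral>\<^sup>+x. indicator {x. s < ?a x} x * indicator {x. t < (f x)\<^sup>2} x * 1 \<partial>lborel)"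
    proof -
      have "(\<integral>\<^sup>+x. indicator {x. s < ?a x} x * indicator {x. t < (f x)\<^sup>2} x * 1 \<partial>lborel)
        = (\<integral>\<^sup>+x. indicator (A \<inter> B) x \<partial>lborel)"
        using sqrt [OF st(2), of f] f(1) a st(1)
        by (intro nn_integral_cong) (auto simp: indicator_def A_def B_def split: if_splits)
      then show ?thesis using A B by simp
    qed
    finally show "(\<integral>\<^sup>+x. indicator {x. s < b x} x * indicator {x. t < (g x)\<^sup>2} x * 1 \<partial>lborel) \<le> \<dots>" .
  qed (auto intro: lborel.sigma_finite_measure_axioms)
  then show ?thesis by simp
qed

subsection \<open>The bottom of the spectrum\<close>

definition L2_inner :: "'a::euclidean_space set \<Rightarrow> ('a \<Rightarrow> real) \<Rightarrow> ('a \<Rightarrow> real) \<Rightarrow> real" where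
  "L2_inner S u v = (LINT x|lebesgue_on S. u x * v x)"

lemma L2_norm_eq_inner: "L2_norm S u = sqrt (L2_inner S u u)"
  by (simp add: L2_norm_def L2_inner_def power2_eq_square)

lemma L2_inner_nonneg: "0 \<le> L2_inner S u u"
  unfolding L2_inner_def by (intro integral_nonneg_AE AE_I2) simp

lemma L2_inner_commute: "L2_inner S u v = L2_inner S v u"
  by (simp add: L2_inner_def mult.commute)

lemma L2_space_measurable: "u \<in> L2_space S \<Longrightarrow> u \<in> borel_measurable (lebesgue_on S)"
  by (simp add: L2_space_def)

lemma integrable_mult_L2:
  assumes "u \<in> L2_space S" "v \<in> L2_space S"
  shows "integrable (lebesgue_on S) (\<lambda>x. u x * v x)"
proof (rule Bochner_Integration.integrable_bound)
  show "integrable (lebesgue_on S) (\<lambda>x. (u x)\<^sup>2 + (v x)\<^sup>2)"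
    using assms by (auto simp: L2_space_def)
  show "(\<lambda>x. u x * v x) \<in> borel_measurable (lebesgue_on S)"
    using assms by (auto simp: L2_space_def)
  have "\<bar>p * q\<bar> \<le> p\<^sup>2 + q\<^sup>2" for p q :: real
    using sum_squares_bound [of "\<bar>p\<bar>" "\<bar>q\<bar>"] mult_nonneg_nonneg [OF abs_ge_zero [of p] abs_ge_zero [of q]]
    unfolding abs_mult power2_abs by linarith
  then show "AE x in lebesgue_on S. norm (u x * v x) \<le> norm ((u x)\<^sup>2 + (v x)\<^sup>2)"
    by simp
qed

lemma L2_space_add_scaled:
  assumes "u \<in> L2_space S" "v \<in> L2_space S"
  shows "(\<lambda>x. u x + c * v x) \<in> L2_space S"
proof -
  have "integrable (lebesgue_on S) (\<lambda>x. (u x)\<^sup>2 + c\<^sup>2 * (v x)\<^sup>2 + 2 * c * (u x * v x))"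
    using assms integrable_mult_L2 [OF assms] by (auto simp: L2_space_def)
  then have "integrable (lebesgue_on S) (\<lambda>x. (u x + c * v x)\<^sup>2)"
    by (simp add: power2_sum power_mult_distrib mult_ac)
  then show ?thesis
    using assms by (auto simp: L2_space_def)
qed

lemma L2_inner_add_scaled:
  assumes "u \<in> L2_space S" "v \<in> L2_space S" "w \<in> L2_space S"
  shows "L2_inner S (\<lambda>x. u x + c * v x) w = L2_inner S u w + c * L2_inner S v w"
proof -
  have "L2_inner S (\<lambda>x. u x + c * v x) w = (LINT x|lebesgue_on S. u x * w x + c * (v x * w x))"
    by (simp add: L2_inner_def algebra_simps)
  also have "\<dots> = L2_inner S u w + c * L2_inner S v w"
    using integrable_mult_L2 [OF assms(1,3)] integrable_mult_L2 [OF assms(2,3)] by (simp add: L2_inner_def)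
  finally show ?thesis .
qed

lemma L2_norm_cong_AE:
  assumes "u \<in> L2_space S" "v \<in> L2_space S" "L2_eq S u v"
  shows "L2_norm S u = L2_norm S v"
proof -
  note [measurable] = L2_space_measurable [OF assms(1)] L2_space_measurable [OF assms(2)]
  have "(LINT x|lebesgue_on S. (u x)\<^sup>2) = (LINT x|lebesgue_on S. (v x)\<^sup>2)"
    using assms(3) by (intro integral_cong_AE) (auto simp: L2_eq_def elim!: eventually_mono)
  then show ?thesis by (simp add: L2_norm_def)
qed

text \<open>
  The infimum \<open>m\<close> of the Rayleigh quotient belongs to the spectrum: positivity of the form
  \<open>q(u) = \<langle>(T - m) u, u\<rangle>\<close> at \<open>u - t (T - m) u\<close> yields \<open>\<parallel>(T - m) u\<parallel>\<^sup>2 \<le> K q(u)\<close>, so a bounded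
  inverse of \<open>T - m\<close> would give \<open>\<parallel>u\<parallel>\<^sup>2 \<le> K' q(u)\<close>, contradicting the choice of \<open>m\<close>.
\<close>
lemma Rayleigh_ge_spectrum_lower_bound:
  fixes T :: "('a::euclidean_space \<Rightarrow> real) \<Rightarrow> 'a \<Rightarrow> real"
  assumes T: "\<And>u. u \<in> L2_space S \<Longrightarrow> T u \<in> L2_space S"
    and T_lin: "\<And>u v c. u \<in> L2_space S \<Longrightarrow> v \<in> L2_space S \<Longrightarrow> T (\<lambda>x. u x + c * v x) = (\<lambda>x. T u x + c * T v x)"
    and T_sym: "\<And>u v. u \<in> L2_space S \<Longrightarrow> v \<in> L2_space S \<Longrightarrow> L2_inner S (T u) v = L2_inner S u (T v)"
    and T_bound: "\<And>u. u \<in> L2_space S \<Longrightarrow> \<bar>L2_inner S (T u) u\<bar> \<le> B * L2_inner S u u"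
    and lam: "\<And>\<nu>. \<nu> \<in> spectrum S T \<Longrightarrow> lam \<le> \<nu>" and v: "v \<in> L2_space S"
  shows "lam * L2_inner S v v \<le> L2_inner S (T v) v"
proof (rule ccontr)
  let ?N = "\<lambda>u. L2_inner S u u"
  assume "\<not> ?thesis"
  then have less: "L2_inner S (T v) v < lam * ?N v" by simp
  have Nv: "0 < ?N v"
    using less T_bound [OF v] L2_inner_nonneg [of S v] by (cases "?N v = 0") auto
  define U where "U = {u \<in> L2_space S. 0 < ?N u}"
  define Q where "Q u = L2_inner S (T u) u / ?N u" for u
  have vU: "v \<in> U" using v Nv by (simp add: U_def)
  have bdd: "bdd_below (Q ` U)"
  proof (rule bdd_belowI2)
    fix u assume "u \<in> U"
    then show "- B \<le> Q u"
      using T_bound [of u] by (simp add: U_def Q_def pos_le_divide_eq)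
  qed
  define m where "m = (INF u\<in>U. Q u)"
  have "m \<le> Q v" unfolding m_def by (rule cINF_lower [OF bdd vU])
  also have "\<dots> < lam" using less Nv by (simp add: Q_def pos_divide_less_eq)
  finally have "m \<notin> spectrum S T" using lam by force
  then have "m \<in> resolvent_set S T" by (simp add: spectrum_def)
  then obtain C where C: "\<And>f. f \<in> L2_space S \<Longrightarrow> \<exists>u\<in>L2_space S.
            L2_eq S (\<lambda>x. T u x - m * u x) f \<and>
            (\<forall>v\<in>L2_space S. L2_eq S (\<lambda>x. T v x - m * v x) f \<longrightarrow> L2_eq S v u) \<and>
            L2_norm S u \<le> C * L2_norm S f"
    unfolding resolvent_set_def by blast
  define F where "F u = (\<lambda>x. T u x + (- m) * u x)" for u
  have F: "F u \<in> L2_space S" if "u \<in> L2_space S" for u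
    unfolding F_def using that by (intro L2_space_add_scaled T)
  define q where "q u = L2_inner S (F u) u" for u
  have q: "q u = L2_inner S (T u) u - m * ?N u" if "u \<in> L2_space S" for u
    unfolding q_def F_def using L2_inner_add_scaled [OF T [OF that] that that, of "- m"] by simp
  have q_nonneg: "0 \<le> q u" if u: "u \<in> L2_space S" for u
  proof (cases "0 < ?N u")
    case True
    then have "m \<le> Q u" unfolding m_def using u by (intro cINF_lower [OF bdd]) (simp add: U_def)
    then show ?thesis using True by (simp add: q [OF u] Q_def pos_le_divide_eq)
  next
    case False
    then have "?N u = 0" using L2_inner_nonneg [of S u] by simp
    then show ?thesis using T_bound [OF u] by (simp add: q [OF u])
  qed
  have F_sym: "L2_inner S (F u) w = L2_inner S u (F w)" if "u \<in> L2_space S" "w \<in> L2_space S" for u w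
    using L2_inner_add_scaled [OF T [OF that(1)] that, of "- m"]
      L2_inner_add_scaled [OF T [OF that(2)] that(2,1), of "- m"] T_sym [OF that]
    by (simp add: F_def L2_inner_commute [of S u])
  have F_lin: "F (\<lambda>x. u x + c * w x) = (\<lambda>x. F u x + c * F w x)" if "u \<in> L2_space S" "w \<in> L2_space S" for u w c
    using T_lin [OF that, of c] by (simp add: F_def fun_eq_iff algebra_simps)
  \<comment> \<open>Chosen so that the form \<open>q\<close> is at most \<open>K\<close> times the
    squared norm; the summand 1 makes it positive.\<close>
  define K where "K = \<bar>B\<bar> + \<bar>m\<bar> + 1"
  have K: "0 < K" by (simp add: K_def)
  have F_le: "?N (F u) \<le> K * q u" if u: "u \<in> L2_space S" for u
  proof -
    \<comment> \<open>Here q(u - F u / K) = q(u) - (2 / K) ||F u||^2 + q(F u) / K^2. With q(F u)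
      \<le> K ||F u||^2, the step 1 / K minimizes the resulting upper bound, and its nonnegativity
      is the claim.\<close>
    let ?t = "- (1 / K)"
    let ?w = "\<lambda>x. u x + ?t * F u x"
    have w: "?w \<in> L2_space S" using L2_space_add_scaled [OF u F [OF u]] .
    have "q ?w = L2_inner S (F u) ?w + ?t * L2_inner S (F (F u)) ?w"
      unfolding q_def F_lin [OF u F [OF u]]
      using L2_inner_add_scaled [OF F [OF u] F [OF F [OF u]] w] .
    also have "L2_inner S (F u) ?w = q u + ?t * ?N (F u)"
      using L2_inner_add_scaled [OF u F [OF u] F [OF u], of ?t]
      by (simp only: q_def L2_inner_commute [of S "F u" ?w] L2_inner_commute [of S u "F u"])
    also have "L2_inner S (F (F u)) ?w = L2_inner S u (F (F u)) + ?t * L2_inner S (F u) (F (F u))"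
      using L2_inner_add_scaled [OF u F [OF u] F [OF F [OF u]], of ?t]
      by (simp only: L2_inner_commute [of S "F (F u)" ?w])
    also have "L2_inner S u (F (F u)) = ?N (F u)" using F_sym [OF u F [OF u]] by simp
    also have "L2_inner S (F u) (F (F u)) = q (F u)" by (simp add: q_def L2_inner_commute)
    finally have "q ?w = q u - 2 * (?N (F u) / K) + q (F u) / K / K"
      by (simp add: algebra_simps)
    moreover have "q (F u) \<le> K * ?N (F u)"
    proof -
      have "q (F u) \<le> B * ?N (F u) - m * ?N (F u)"
        using q [OF F [OF u]] T_bound [OF F [OF u]] by simp
      also have "\<dots> = (B - m) * ?N (F u)" by (simp add: algebra_simps)
      also have "\<dots> \<le> K * ?N (F u)"
        by (intro mult_right_mono L2_inner_nonneg) (simp add: K_def)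
      finally show ?thesis .
    qed
    then have "q (F u) / K / K \<le> ?N (F u) / K"
      using K by (simp add: field_simps)
    ultimately have "?N (F u) / K \<le> q u"
      using q_nonneg [OF w] by linarith
    then show ?thesis using K by (simp add: field_simps)
  qed
  \<comment> \<open>\<open>u\<close> itself solves the equation with right-hand side
    \<open>F u\<close>, so the uniqueness clause identifies it with the solution that carries the
    norm bound \<open>C\<close>.\<close>
  have N_le: "?N u \<le> C\<^sup>2 * ?N (F u)" if u: "u \<in> L2_space S" for u
  proof -
    have F_eq: "F u = (\<lambda>x. T u x - m * u x)" by (simp add: F_def)
    obtain w where w: "w \<in> L2_space S" "L2_eq S u w" "L2_norm S w \<le> C * L2_norm S (F u)"
      using C [OF F [OF u]] u by (auto simp: F_eq L2_eq_def)
    then have "sqrt (?N u) \<le> C * sqrt (?N (F u))"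
      using L2_norm_cong_AE [OF u w(1,2)] by (simp add: L2_norm_eq_inner)
    then have "(sqrt (?N u))\<^sup>2 \<le> (C * sqrt (?N (F u)))\<^sup>2"
      using L2_inner_nonneg [of S u] by (intro power_mono) auto
    then show ?thesis by (simp add: power_mult_distrib L2_inner_nonneg)
  qed
  \<comment> \<open>From ||u||^2 \<le> C^2 ||F u||^2 \<le> C^2 K q(u) the quotient exceeds m by a
    fixed gap; the summand 1 keeps the denominator positive for C = 0.\<close>
  define \<epsilon> where "\<epsilon> = 1 / (C\<^sup>2 * K + 1)"
  have D: "0 < C\<^sup>2 * K + 1" using K by (intro add_nonneg_pos) auto
  then have \<epsilon>: "0 < \<epsilon>" by (simp add: \<epsilon>_def)
  have "m + \<epsilon> \<le> Q u" if "u \<in> U" for u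
  proof -
    have u: "u \<in> L2_space S" and Nu: "0 < ?N u" using that by (auto simp: U_def)
    have "?N u \<le> C\<^sup>2 * (K * q u)"
      using N_le [OF u] F_le [OF u] by (meson mult_left_mono order_trans zero_le_power2)
    also have "\<dots> \<le> (C\<^sup>2 * K + 1) * q u" using q_nonneg [OF u] by (simp add: algebra_simps)
    finally have "\<epsilon> * ?N u \<le> q u" using D by (simp add: \<epsilon>_def field_simps)
    then have "(m + \<epsilon>) * ?N u \<le> L2_inner S (T u) u" by (simp add: q [OF u] algebra_simps)
    then show ?thesis using Nu by (simp add: Q_def pos_le_divide_eq)
  qed
  then have "m + \<epsilon> \<le> m" unfolding m_def using vU by (intro cINF_greatest) auto
  then show False using \<epsilon> by simp
qed

section \<open>The nonlocal operator as a bounded symmetric operator on L^2\<close>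

text \<open>Instantiated twice, for \<open>\<Omega>\<close> with \<open>a\<close> and for the ball
  with the rearranged potential. Of the potential it asks measurability and a bound, both inherited
  by the rearrangement.\<close>

locale bounded_nonlocal =
  fixes J :: "'a::euclidean_space \<Rightarrow> real" and S :: "'a set" and a :: "'a \<Rightarrow> real" and A :: real
  assumes S: "S \<in> lmeasurable" "0 < measure lebesgue S"
    and J_meas [measurable]: "J \<in> borel_measurable borel" and J_nonneg: "\<And>x. 0 \<le> J x"
    and J_le: "\<And>x. J x \<le> J 0" and J_minus: "\<And>x. J (- x) = J x"
    and a_meas [measurable]: "a \<in> borel_measurable (lebesgue_on S)" and a_le: "\<And>x. x \<in> S \<Longrightarrow> \<bar>a x\<bar> \<le> A"
begin

abbreviation "M \<equiv> lebesgue_on S"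

sublocale M: finite_measure M
  using S(1) by (rule finite_measure_lebesgue_on)

sublocale MM: pair_sigma_finite M M ..

lemma id_measurable [measurable]: "(\<lambda>x. x) \<in> borel_measurable M"
  by (intro measurable_restrict_space1 measurable_completion) simp

lemma diff_measurable [measurable]: "(\<lambda>z. fst z - snd z) \<in> borel_measurable (M \<Otimes>\<^sub>M M)"
  using measurable_compose [OF measurable_fst id_measurable] measurable_compose [OF measurable_snd id_measurable]
  by (intro borel_measurable_diff) auto

lemma kernel_measurable [measurable]: "(\<lambda>z. J (fst z - snd z)) \<in> borel_measurable (M \<Otimes>\<^sub>M M)"
  by (rule measurable_compose [OF diff_measurable J_meas])

lemma L2_imp_integrable:
  assumes "u \<in> L2_space S"
  shows "integrable M u"
proof (rule Bochner_Integration.integrable_bound)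
  show "integrable M (\<lambda>x. 1 + (u x)\<^sup>2)" using assms by (auto simp: L2_space_def)
  have "\<bar>p\<bar> \<le> 1 + p\<^sup>2" for p :: real
    using sum_squares_bound [of 1 "\<bar>p\<bar>"] by simp
  then show "AE x in M. norm (u x) \<le> norm (1 + (u x)\<^sup>2)" by simp
qed (rule L2_space_measurable [OF assms])

lemma const_L2: "(\<lambda>x. c) \<in> L2_space S"
  by (simp add: L2_space_def)

lemma bounded_mult_L2:
  assumes u: "u \<in> L2_space S" and [measurable]: "h \<in> borel_measurable M" and h: "\<And>x. x \<in> S \<Longrightarrow> \<bar>h x\<bar> \<le> H"
  shows "(\<lambda>x. h x * u x) \<in> L2_space S"
proof -
  note [measurable] = L2_space_measurable [OF u]
  have "integrable M (\<lambda>x. (h x * u x)\<^sup>2)"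
  proof (rule Bochner_Integration.integrable_bound)
    show "integrable M (\<lambda>x. H\<^sup>2 * (u x)\<^sup>2)" using u by (auto simp: L2_space_def)
    have "(h x * u x)\<^sup>2 \<le> H\<^sup>2 * (u x)\<^sup>2" if "x \<in> S" for x
      using h [OF that] by (auto simp: power_mult_distrib intro!: mult_right_mono) (metis abs_ge_zero power2_abs power_mono)
    then show "AE x in M. norm ((h x * u x)\<^sup>2) \<le> norm (H\<^sup>2 * (u x)\<^sup>2)"
      by (intro AE_I2) (auto simp: space_restrict_space)
  qed measurable
  then show ?thesis by (simp add: L2_space_def)
qed

definition conv :: "('a \<Rightarrow> real) \<Rightarrow> 'a \<Rightarrow> real" where
  "conv u x = (LINT y|M. J (x - y) * u y)"

lemma nonlocal_operator_eq: "nonlocal_operator J S a u = (\<lambda>x. a x * u x + (- 1) * conv u x)"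
  by (simp add: fun_eq_iff nonlocal_operator_def conv_def)

lemma kernel_integrable:
  assumes "u \<in> L2_space S"
  shows "integrable M (\<lambda>y. J (x - y) * u y)"
proof (rule Bochner_Integration.integrable_bound)
  show "integrable M (\<lambda>y. J 0 * u y)" using L2_imp_integrable [OF assms] by simp
  show "(\<lambda>y. J (x - y) * u y) \<in> borel_measurable M"
    using L2_space_measurable [OF assms] by measurable
  show "AE y in M. norm (J (x - y) * u y) \<le> norm (J 0 * u y)"
    using J_nonneg J_le by (auto simp: abs_mult intro!: mult_right_mono)
qed

lemma conv_measurable [measurable]:
  assumes "u \<in> L2_space S"
  shows "conv u \<in> borel_measurable M"
proof -
  note [measurable] = L2_space_measurable [OF assms]
  have "(\<lambda>(x, y). J (x - y) * u y) \<in> borel_measurable (M \<Otimes>\<^sub>M M)"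
    using kernel_measurable by (simp add: case_prod_beta)
  then show ?thesis
    unfolding conv_def [abs_def] by (rule M.borel_measurable_lebesgue_integral)
qed

text \<open>As the kernel is bounded, convolution yields bounded functions; on a set of finite
  measure these lie in L^2, and the same estimate later bounds the quadratic form.\<close>

lemma abs_conv_le:
  assumes "u \<in> L2_space S"
  shows "\<bar>conv u x\<bar> \<le> J 0 * (LINT y|M. \<bar>u y\<bar>)"
proof -
  have "\<bar>conv u x\<bar> \<le> (LINT y|M. \<bar>J (x - y) * u y\<bar>)"
    unfolding conv_def by (rule integral_abs_bound)
  also have "\<dots> \<le> (LINT y|M. J 0 * \<bar>u y\<bar>)"
  proof (rule integral_mono)
    show "integrable M (\<lambda>y. \<bar>J (x - y) * u y\<bar>)" by (intro integrable_abs kernel_integrable assms)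
    show "integrable M (\<lambda>y. J 0 * \<bar>u y\<bar>)" by (intro integrable_mult_right integrable_abs L2_imp_integrable assms)
    show "\<bar>J (x - y) * u y\<bar> \<le> J 0 * \<bar>u y\<bar>" for y
      using J_nonneg [of "x - y"] J_le by (simp add: abs_mult mult_right_mono)
  qed
  finally show ?thesis by simp
qed

lemma conv_L2:
  assumes "u \<in> L2_space S"
  shows "conv u \<in> L2_space S"
  \<comment> \<open>\<open>conv u\<close> is regarded as a bounded multiplier of the constant
    1.\<close>
  using bounded_mult_L2 [OF const_L2 [of 1] conv_measurable [OF assms] abs_conv_le [OF assms]] by simp

lemma conv_linear:
  assumes "u \<in> L2_space S" "v \<in> L2_space S"
  shows "conv (\<lambda>x. u x + c * v x) x = conv u x + c * conv v x"
proof -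
  have "conv (\<lambda>x. u x + c * v x) x = (LINT y|M. J (x - y) * u y + c * (J (x - y) * v y))"
    by (simp add: conv_def algebra_simps)
  then show ?thesis
    using kernel_integrable [OF assms(1), of x] kernel_integrable [OF assms(2), of x] by (simp add: conv_def)
qed

lemma kernel_integrable2:
  assumes u: "u \<in> L2_space S" and v: "v \<in> L2_space S"
  shows "integrable (M \<Otimes>\<^sub>M M) (\<lambda>(x, y). J (x - y) * u y * v x)"
proof (rule MM.Fubini_integrable)
  note [measurable] = L2_space_measurable [OF u] L2_space_measurable [OF v]
  show meas: "(\<lambda>(x, y). J (x - y) * u y * v x) \<in> borel_measurable (M \<Otimes>\<^sub>M M)"
    using kernel_measurable by (simp add: case_prod_beta)
  show "AE x in M. integrable M (\<lambda>y. case (x, y) of (x, y) \<Rightarrow> J (x - y) * u y * v x)"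
    using kernel_integrable [OF u] by simp
  show "integrable M (\<lambda>x. LINT y|M. norm (case (x, y) of (x, y) \<Rightarrow> J (x - y) * u y * v x))"
  proof (rule Bochner_Integration.integrable_bound)
    show "integrable M (\<lambda>x. J 0 * (LINT y|M. \<bar>u y\<bar>) * v x)"
      using L2_imp_integrable [OF v] by simp
    show "(\<lambda>x. LINT y|M. norm (case (x, y) of (x, y) \<Rightarrow> J (x - y) * u y * v x)) \<in> borel_measurable M"
      using measurable_compose [OF meas borel_measurable_norm] by (intro M.borel_measurable_lebesgue_integral) (simp add: case_prod_beta)
    have "(LINT y|M. \<bar>J (x - y) * u y * v x\<bar>) \<le> J 0 * (LINT y|M. \<bar>u y\<bar>) * \<bar>v x\<bar>" for x
    proof -
      have "(LINT y|M. \<bar>J (x - y) * u y * v x\<bar>) \<le> (LINT y|M. J 0 * \<bar>u y\<bar> * \<bar>v x\<bar>)"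
      proof (rule integral_mono)
        show "integrable M (\<lambda>y. \<bar>J (x - y) * u y * v x\<bar>)"
          by (intro integrable_abs integrable_mult_left kernel_integrable u)
        show "integrable M (\<lambda>y. J 0 * \<bar>u y\<bar> * \<bar>v x\<bar>)"
          by (intro integrable_mult_left integrable_mult_right integrable_abs L2_imp_integrable u)
        show "\<bar>J (x - y) * u y * v x\<bar> \<le> J 0 * \<bar>u y\<bar> * \<bar>v x\<bar>" for y
          using J_nonneg [of "x - y"] J_le by (simp add: abs_mult mult_right_mono)
      qed
      then show ?thesis by simp
    qed
    then show "AE x in M. norm (LINT y|M. norm (case (x, y) of (x, y) \<Rightarrow> J (x - y) * u y * v x))
                \<le> norm (J 0 * (LINT y|M. \<bar>u y\<bar>) * v x)"
      using J_nonneg [of 0] by (intro AE_I2) (simp add: abs_mult)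
  qed
qed

lemma conv_symmetric:
  assumes u: "u \<in> L2_space S" and v: "v \<in> L2_space S"
  shows "L2_inner S (conv u) v = L2_inner S u (conv v)"
proof -
  have J: "J (x - y) = J (y - x)" for x y using J_minus [of "x - y"] by simp
  have "L2_inner S (conv u) v = (LINT x|M. LINT y|M. J (x - y) * u y * v x)"
    by (simp add: L2_inner_def conv_def)
  also have "\<dots> = (LINT y|M. LINT x|M. J (x - y) * u y * v x)"
    by (rule MM.Fubini_integral [OF kernel_integrable2 [OF u v], symmetric])
  also have "\<dots> = (LINT y|M. LINT x|M. u y * (J (y - x) * v x))"
    by (simp add: J mult_ac)
  also have "\<dots> = L2_inner S u (conv v)"
    by (simp add: L2_inner_def conv_def)
  finally show ?thesis .
qed

lemma integral_abs_square_le: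
  assumes u: "u \<in> L2_space S"
  shows "(LINT y|M. \<bar>u y\<bar>)\<^sup>2 \<le> measure lebesgue S * L2_inner S u u"
proof -
  define I where "I = (LINT y|M. \<bar>u y\<bar>)"
  define V where "V = measure lebesgue S"
  \<comment> \<open>The mean of |u|: expanding its nonnegative variance gives the Cauchy--Schwarz
    inequality against the constant 1.\<close>
  define c where "c = I / V"
  have V: "0 < V" "measure M S = V" using S by (auto simp: V_def measure_restrict_space)
  have int: "integrable M (\<lambda>y. \<bar>u y\<bar>)" "integrable M (\<lambda>y. u y * u y)"
    using L2_imp_integrable [OF u] integrable_mult_L2 [OF u u] by auto
  have "0 \<le> (LINT y|M. (\<bar>u y\<bar> - c)\<^sup>2)" by (intro integral_nonneg_AE AE_I2) simp
  also have "\<dots> = (LINT y|M. u y * u y - 2 * c * \<bar>u y\<bar> + c\<^sup>2)"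
    by (intro Bochner_Integration.integral_cong refl) (simp add: power2_eq_square algebra_simps)
  also have "\<dots> = L2_inner S u u - 2 * c * I + c\<^sup>2 * V"
    using int V by (simp add: L2_inner_def I_def space_restrict_space)
  also have "\<dots> = L2_inner S u u - I\<^sup>2 / V"
    using V by (simp add: c_def power2_eq_square field_simps)
  finally show ?thesis using V by (simp add: I_def [symmetric] V_def [symmetric] field_simps)
qed

lemma a_mult_L2: "u \<in> L2_space S \<Longrightarrow> (\<lambda>x. a x * u x) \<in> L2_space S"
  using bounded_mult_L2 [OF _ a_meas a_le] .

lemma inner_nonlocal_operator:
  assumes "u \<in> L2_space S" "v \<in> L2_space S"
  shows "L2_inner S (nonlocal_operator J S a u) v = L2_inner S (\<lambda>x. a x * u x) v - L2_inner S (conv u) v"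
  unfolding nonlocal_operator_eq
  using L2_inner_add_scaled [OF a_mult_L2 [OF assms(1)] conv_L2 [OF assms(1)] assms(2), of "- 1"] by simp

lemma Rayleigh_nonlocal_operator:
  assumes lam: "\<And>\<nu>. \<nu> \<in> spectrum S (nonlocal_operator J S a) \<Longrightarrow> lam \<le> \<nu>" and v: "v \<in> L2_space S"
  shows "lam * L2_inner S v v \<le> L2_inner S (nonlocal_operator J S a v) v"
proof (rule Rayleigh_ge_spectrum_lower_bound [OF _ _ _ _ lam v])
  note au = a_mult_L2 and T_eq = nonlocal_operator_eq and inner = inner_nonlocal_operator
  fix u v assume u: "u \<in> L2_space S" and v: "v \<in> L2_space S"
  show "nonlocal_operator J S a u \<in> L2_space S"
    unfolding T_eq by (intro L2_space_add_scaled au conv_L2 u)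
  show "nonlocal_operator J S a (\<lambda>x. u x + c * v x) = (\<lambda>x. nonlocal_operator J S a u x + c * nonlocal_operator J S a v x)" for c
    unfolding T_eq using conv_linear [OF u v] by (simp add: fun_eq_iff algebra_simps)
  show "L2_inner S (nonlocal_operator J S a u) v = L2_inner S u (nonlocal_operator J S a v)"
    using inner [OF u v] inner [OF v u] conv_symmetric [OF u v]
    by (simp add: L2_inner_commute [of S u]) (simp add: L2_inner_def mult_ac)
  show "\<bar>L2_inner S (nonlocal_operator J S a u) u\<bar> \<le> (A + J 0 * measure lebesgue S) * L2_inner S u u"
  proof -
    have "\<bar>L2_inner S (\<lambda>x. a x * u x) u\<bar> \<le> (LINT x|M. \<bar>a x * u x * u x\<bar>)"
      unfolding L2_inner_def by (rule integral_abs_bound)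
    also have "\<dots> \<le> (LINT x|M. A * (u x * u x))"
    proof (rule integral_mono)
      show "integrable M (\<lambda>x. \<bar>a x * u x * u x\<bar>)" "integrable M (\<lambda>x. A * (u x * u x))"
        using integrable_mult_L2 [OF au [OF u] u] integrable_mult_L2 [OF u u] by auto
      fix x assume "x \<in> space M"
      then have "\<bar>a x\<bar> * (u x * u x) \<le> A * (u x * u x)"
        using a_le by (intro mult_right_mono) (auto simp: space_restrict_space)
      then show "\<bar>a x * u x * u x\<bar> \<le> A * (u x * u x)" by (simp add: abs_mult mult.assoc)
    qed
    also have "\<dots> = A * L2_inner S u u" by (simp add: L2_inner_def)
    finally have 1: "\<bar>L2_inner S (\<lambda>x. a x * u x) u\<bar> \<le> A * L2_inner S u u" .
    have "\<bar>L2_inner S (conv u) u\<bar> \<le> (LINT x|M. \<bar>conv u x * u x\<bar>)"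
      unfolding L2_inner_def by (rule integral_abs_bound)
    also have "\<dots> \<le> (LINT x|M. J 0 * (LINT y|M. \<bar>u y\<bar>) * \<bar>u x\<bar>)"
    proof (rule integral_mono)
      show "integrable M (\<lambda>x. \<bar>conv u x * u x\<bar>)" by (intro integrable_abs integrable_mult_L2 conv_L2 u)
      show "integrable M (\<lambda>x. J 0 * (LINT y|M. \<bar>u y\<bar>) * \<bar>u x\<bar>)"
        by (intro integrable_mult_right integrable_abs L2_imp_integrable u)
      show "\<bar>conv u x * u x\<bar> \<le> J 0 * (LINT y|M. \<bar>u y\<bar>) * \<bar>u x\<bar>" for x
        using abs_conv_le [OF u, of x] by (simp only: abs_mult mult_right_mono abs_ge_zero)
    qed
    also have "\<dots> = J 0 * (LINT y|M. \<bar>u y\<bar>)\<^sup>2" by (simp add: power2_eq_square)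
    also have "\<dots> \<le> J 0 * (measure lebesgue S * L2_inner S u u)"
      by (intro mult_left_mono integral_abs_square_le u J_nonneg)
    finally show ?thesis using 1 inner [OF u u] by (simp add: algebra_simps)
  qed
qed

end

section \<open>Inner products as nonnegative integrals of functions extended by zero\<close>

lemma nn_integral_lebesgue_on:
  assumes "S \<in> sets lebesgue"
  shows "(\<integral>\<^sup>+x. F x \<partial>lebesgue_on S) = (\<integral>\<^sup>+x. F x * indicator S x \<partial>lborel)"
  using assms by (simp add: nn_integral_restrict_space nn_integral_completion)

text \<open>The bridge from the real integrals in the operators to the \<open>ennreal\<close>
  integrals in the rearrangement inequalities.\<close>

lemma ennreal_L2_inner:
  assumes S: "S \<in> sets lebesgue" and uv: "u \<in> L2_space S" "v \<in> L2_space S"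
    and nonneg: "\<And>x. x \<in> S \<Longrightarrow> 0 \<le> u x" "\<And>x. x \<in> S \<Longrightarrow> 0 \<le> v x"
  shows "ennreal (L2_inner S u v) = (\<integral>\<^sup>+x. ennreal (u x * v x) * indicator S x \<partial>lborel)"
  unfolding L2_inner_def nn_integral_lebesgue_on [OF S, symmetric]
  using nonneg by (intro nn_integral_eq_integral [symmetric] integrable_mult_L2 uv AE_I2) (auto simp: space_restrict_space)

context bounded_nonlocal
begin

lemma S_lebesgue: "S \<in> sets lebesgue"
  using S(1) by auto

lemma conv_nonneg: "(\<And>x. x \<in> S \<Longrightarrow> 0 \<le> u x) \<Longrightarrow> 0 \<le> conv u x"
  unfolding conv_def using J_nonneg by (intro integral_nonneg_AE AE_I2) (simp add: space_restrict_space)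

lemma ennreal_conv:
  assumes u: "u \<in> L2_space S" "\<And>x. x \<in> S \<Longrightarrow> 0 \<le> u x"
  shows "ennreal (conv u x) = (\<integral>\<^sup>+y. ennreal (indicator S y * u y) * ennreal (J (x - y)) \<partial>lborel)"
proof -
  have "ennreal (conv u x) = (\<integral>\<^sup>+y. ennreal (J (x - y) * u y) \<partial>M)"
    unfolding conv_def using u(2) J_nonneg
    by (intro nn_integral_eq_integral [symmetric] kernel_integrable u(1) AE_I2) (auto simp: space_restrict_space)
  also have "\<dots> = (\<integral>\<^sup>+y. ennreal (indicator S y * u y) * ennreal (J (x - y)) \<partial>lborel)"
    unfolding nn_integral_lebesgue_on [OF S_lebesgue] using u(2) J_nonneg
    by (intro nn_integral_cong) (auto simp: indicator_def ennreal_mult mult.commute)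
  finally show ?thesis .
qed

lemma ennreal_inner_conv:
  assumes u: "u \<in> L2_space S" "\<And>x. x \<in> S \<Longrightarrow> 0 \<le> u x"
    and [measurable]: "(\<lambda>x. indicator S x * u x) \<in> borel_measurable borel"
  shows "ennreal (L2_inner S (conv u) u) =
    (\<integral>\<^sup>+x. \<integral>\<^sup>+y. ennreal (indicator S x * u x) * ennreal (indicator S y * u y) * ennreal (J (x - y)) \<partial>lborel \<partial>lborel)"
proof -
  have "ennreal (L2_inner S (conv u) u) = (\<integral>\<^sup>+x. ennreal (conv u x * u x) * indicator S x \<partial>lborel)"
    by (rule ennreal_L2_inner [OF S_lebesgue conv_L2 [OF u(1)] u(1) conv_nonneg [OF u(2)] u(2)])
  also have "\<dots> = (\<integral>\<^sup>+x. ennreal (indicator S x * u x) * ennreal (conv u x) \<partial>lborel)"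
    using u(2) conv_nonneg [OF u(2)]
    by (intro nn_integral_cong) (auto simp: indicator_def ennreal_mult mult.commute)
  also have "\<dots> = (\<integral>\<^sup>+x. \<integral>\<^sup>+y. ennreal (indicator S x * u x) * (ennreal (indicator S y * u y) * ennreal (J (x - y))) \<partial>lborel \<partial>lborel)"
  proof (rule nn_integral_cong)
    fix x
    show "ennreal (indicator S x * u x) * ennreal (conv u x) =
        (\<integral>\<^sup>+y. ennreal (indicator S x * u x) * (ennreal (indicator S y * u y) * ennreal (J (x - y))) \<partial>lborel)"
      by (subst nn_integral_cmult) (simp_all add: ennreal_conv u)
  qed
  finally show ?thesis by (simp only: mult.assoc)
qed

lemma ennreal_inner_a_mult:
  assumes u: "u \<in> L2_space S" "\<And>x. x \<in> S \<Longrightarrow> 0 \<le> u x" and a: "\<And>x. x \<in> S \<Longrightarrow> 0 \<le> a x"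
  shows "ennreal (L2_inner S (\<lambda>x. a x * u x) u) =
    (\<integral>\<^sup>+x. ennreal (indicator S x * a x) * ennreal ((indicator S x * u x)\<^sup>2) \<partial>lborel)"
proof -
  have "ennreal (L2_inner S (\<lambda>x. a x * u x) u) = (\<integral>\<^sup>+x. ennreal (a x * u x * u x) * indicator S x \<partial>lborel)"
    using a u by (intro ennreal_L2_inner S_lebesgue a_mult_L2) auto
  also have "\<dots> = (\<integral>\<^sup>+x. ennreal (indicator S x * a x) * ennreal ((indicator S x * u x)\<^sup>2) \<partial>lborel)"
    using a u(2) by (intro nn_integral_cong) (auto simp: indicator_def power2_eq_square mult.assoc simp flip: ennreal_mult)
  finally show ?thesis .
qed

lemma ennreal_inner_self:
  assumes u: "u \<in> L2_space S" "\<And>x. x \<in> S \<Longrightarrow> 0 \<le> u x"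
  shows "ennreal (L2_inner S u u) = (\<integral>\<^sup>+x. ennreal (indicator S x * u x) * ennreal (indicator S x * u x) \<partial>lborel)"
proof -
  have "ennreal (L2_inner S u u) = (\<integral>\<^sup>+x. ennreal (u x * u x) * indicator S x \<partial>lborel)"
    by (rule ennreal_L2_inner [OF S_lebesgue u(1) u(1) u(2) u(2)])
  also have "\<dots> = (\<integral>\<^sup>+x. ennreal (indicator S x * u x) * ennreal (indicator S x * u x) \<partial>lborel)"
    using u(2) by (intro nn_integral_cong) (auto simp: indicator_def simp flip: ennreal_mult)
  finally show ?thesis .
qed

end

section \<open>Comparison of the Rayleigh quotients\<close>

theorem theorem4p1:
  fixes J :: "real ^ 'n \<Rightarrow> real"
    and \<Omega> \<Omega>s :: "(real ^ 'n) set"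
    and a :: "real ^ 'n \<Rightarrow> real"
    and r lam1 lam1s :: real
  assumes J_cont: "continuous_on UNIV J"
    and J_nonneg: "\<And>x. 0 \<le> J x"
    and J_symmetric: "\<And>x y. norm x = norm y \<Longrightarrow> J x = J y"
    and J_decreasing: "\<And>x y. norm x \<le> norm y \<Longrightarrow> J y \<le> J x"
    and J_pos: "0 < J 0"
    and J_integral: "has_bochner_integral lebesgue J 1"
    and \<Omega>_open: "open \<Omega>"
    and \<Omega>_bounded: "bounded \<Omega>"
    and a_cont: "continuous_on (closure \<Omega>) a"
    and a_nonneg: "\<And>x. x \<in> closure \<Omega> \<Longrightarrow> 0 \<le> a x"
    and \<Omega>s_ball: "\<Omega>s = ball 0 r"
    and \<Omega>s_measure: "measure lebesgue \<Omega>s = measure lebesgue \<Omega>"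
    and first: "first_eigenvalue \<Omega> (nonlocal_operator J \<Omega> a) lam1"
    and first_star: "first_eigenvalue \<Omega>s
          (nonlocal_operator J \<Omega>s (symmetric_increasing_rearrangement \<Omega> a)) lam1s"
  shows "lam1 \<ge> lam1s"
proof -
  let ?as = "symmetric_increasing_rearrangement \<Omega> a"
  obtain \<phi> where eig: "eigenfunction \<Omega> (nonlocal_operator J \<Omega> a) lam1 \<phi>"
    and \<phi>_cont: "continuous_on \<Omega> \<phi>" and \<phi>_pos: "\<And>x. x \<in> \<Omega> \<Longrightarrow> 0 < \<phi> x"
    using first by (auto simp: first_eigenvalue_def)
  have \<phi>: "\<phi> \<in> L2_space \<Omega>" and \<phi>_neq: "\<not> L2_eq \<Omega> \<phi> (\<lambda>x. 0)"
    and \<phi>_eq: "L2_eq \<Omega> (nonlocal_operator J \<Omega> a \<phi>) (\<lambda>x. lam1 * \<phi> x)"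
    using eig by (auto simp: eigenfunction_def)
  have \<phi>_nonneg: "0 \<le> \<phi> x" if "x \<in> \<Omega>" for x using \<phi>_pos [OF that] by simp
  have \<Omega>: "\<Omega> \<in> lmeasurable" using \<Omega>_bounded \<Omega>_open by (rule lmeasurable_open)
  have \<Omega>_borel [measurable]: "\<Omega> \<in> sets borel" using \<Omega>_open by simp
  obtain R where R: "\<Omega> \<subseteq> cball 0 R" using \<Omega>_bounded unfolding bounded_iff by (auto simp: subset_eq)
  \<comment> \<open>On the empty set every function vanishes almost everywhere, which an
    eigenfunction does not. A nonempty open set has positive measure, and this in turn forces r >
    0.\<close>
  have "\<Omega> \<noteq> {}" using \<phi>_neq by (auto simp: L2_eq_def intro!: AE_I2)
  then have \<Omega>_pos: "0 < measure lebesgue \<Omega>"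
    using open_not_negligible [OF \<Omega>_open] negligible_iff_measure0 [OF \<Omega>] measure_nonneg [of lebesgue \<Omega>] by linarith
  then have r: "0 < r" using \<Omega>s_measure unfolding \<Omega>s_ball by (cases "0 < r") (auto simp: not_less ball_empty)
  have vol: "unit_ball_vol (real DIM(real^'n)) * r ^ DIM(real^'n) = measure lebesgue \<Omega>"
    using \<Omega>s_measure content_ball [of r "0 :: real^'n"] r unfolding \<Omega>s_ball by simp
  have J_meas [measurable]: "J \<in> borel_measurable borel" using J_cont by (rule borel_measurable_continuous_onI)
  have J_minus: "J (- x) = J x" for x by (rule J_symmetric) simp
  have J_le: "J x \<le> J 0" for x by (rule J_decreasing) simp
  have a_meas: "(\<lambda>x. indicator \<Omega> x * a x) \<in> borel_measurable borel"
    using borel_measurable_continuous_on_indicator [OF \<Omega>_borel continuous_on_subset [OF a_cont closure_subset]] by simp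
  have a0: "0 \<le> a x" if "x \<in> \<Omega>" for x using a_nonneg closure_subset that by blast
  define f where "f x = indicator \<Omega> x * \<phi> x" for x
  have f_meas [measurable]: "f \<in> borel_measurable borel"
    using borel_measurable_continuous_on_indicator [OF \<Omega>_borel \<phi>_cont] by (simp add: f_def [abs_def])
  have f: "0 \<le> f x" "x \<notin> \<Omega> \<Longrightarrow> f x = 0" for x
    using \<phi>_nonneg by (auto simp: f_def indicator_def)
  have "compact (a ` closure \<Omega>)"
    using a_cont \<Omega>_bounded by (intro compact_continuous_image) (auto simp: compact_closure)
  then obtain A where A: "\<And>x. x \<in> closure \<Omega> \<Longrightarrow> \<bar>a x\<bar> \<le> A"
    using compact_imp_bounded bounded_iff by (metis image_eqI real_norm_def)
  have A': "\<bar>a x\<bar> \<le> A" if "x \<in> \<Omega>" for x using A closure_subset that by blast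
  have A0: "0 \<le> A" using \<open>\<Omega> \<noteq> {}\<close> A' by force
  have lev: "{x \<in> \<Omega>. t < \<bar>a x\<bar>} \<in> sets lebesgue" "{x \<in> \<Omega>. t < \<bar>f x\<bar>} \<in> sets lebesgue" for t
  proof -
    note [measurable] = a_meas
    have "{x \<in> \<Omega>. t < \<bar>indicator \<Omega> x * a x\<bar>} \<in> sets borel" by measurable
    moreover have "{x \<in> \<Omega>. t < \<bar>indicator \<Omega> x * a x\<bar>} = {x \<in> \<Omega>. t < \<bar>a x\<bar>}" by auto
    ultimately show "{x \<in> \<Omega>. t < \<bar>a x\<bar>} \<in> sets lebesgue" by simp
    show "{x \<in> \<Omega>. t < \<bar>f x\<bar>} \<in> sets lebesgue"
      by (rule superlevel_sets_lebesgue [OF \<Omega> f_meas])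
  qed
  have aM: "a \<in> borel_measurable (lebesgue_on \<Omega>)"
  proof -
    have "(\<lambda>x. indicator \<Omega> x * a x) \<in> borel_measurable (lebesgue_on \<Omega>)"
      using a_meas by (intro measurable_restrict_space1 measurable_completion) simp
    then show ?thesis by (rule measurable_cong [THEN iffD1, rotated]) (simp add: space_restrict_space)
  qed
  interpret B: bounded_nonlocal J \<Omega> a A
    using \<Omega> \<Omega>_pos J_nonneg J_le J_minus aM A' by unfold_locales auto

  define g where "g = symmetric_decreasing_rearrangement \<Omega> f"
  have g_meas [measurable]: "g \<in> borel_measurable borel"
    unfolding g_def by (rule symmetric_decreasing_rearrangement_borel [OF \<Omega> lev(2)])
  have g0: "0 \<le> g x" for x by (simp add: g_def symmetric_decreasing_rearrangement_nonneg)
  \<comment> \<open>The level set of \<open>g\<close> at 0 is a punctured ball with the volume of {f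
    > 0}, which is at most that of \<Omega>, so its radius is at most r.\<close>
  have g_out: "g x = 0" if "x \<notin> \<Omega>s" for x
  proof -
    obtain \<rho> where \<rho>: "0 \<le> \<rho>" "emeasure lborel (ball (0::real^'n) \<rho>) = emeasure lborel {x. 0 < f x}"
        "{x. 0 < g x} = ball 0 \<rho> - {0}"
      using superlevel_symmetric_decreasing_rearrangement' [OF \<Omega> f_meas f order_refl] unfolding g_def by metis
    have "{x. 0 < f x} \<subseteq> \<Omega>" using f(2) by force
    then have "emeasure lborel (ball (0::real^'n) \<rho>) \<le> emeasure lborel \<Omega>"
      unfolding \<rho>(2) by (intro emeasure_mono) auto
    also have "\<dots> = ennreal (measure lebesgue \<Omega>)"
      using emeasure_eq_measure2 [OF \<Omega>] \<Omega>_borel by simp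
    also have "\<dots> = emeasure lborel (ball (0::real^'n) r)"
      using r by (simp add: emeasure_ball vol [symmetric])
    finally have "\<rho> ^ DIM(real^'n) \<le> r ^ DIM(real^'n)"
      using \<rho>(1) r by (simp add: emeasure_ball)
    then have "\<rho> \<le> r" using \<rho>(1) r by (simp add: power_mono_iff)
    then have "x \<notin> {x. 0 < g x}" using that unfolding \<rho>(3) \<Omega>s_ball by auto
    then show ?thesis using g0 [of x] by simp
  qed
  define b where "b x = indicator \<Omega>s x * ?as x" for x
  have b_meas [measurable]: "b \<in> borel_measurable borel"
    using symmetric_increasing_rearrangement_borel [OF \<Omega> lev(1) vol] r by (simp add: b_def [abs_def] \<Omega>s_ball)
  have as0: "0 \<le> ?as x" for x by (rule symmetric_increasing_rearrangement_nonneg)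
  \<comment> \<open>No point of \<Omega> lies above level \<open>A\<close>, so the closed ball cut
    out of the level set of the rearrangement has the full volume of \<Omega>s and leaves nothing
    over.\<close>
  have as_le: "\<bar>?as x\<bar> \<le> A" if "x \<in> \<Omega>s" for x
  proof -
    obtain \<rho> where \<rho>: "0 \<le> \<rho>" "emeasure lborel (cball (0::real^'n) \<rho>) = ennreal (measure lebesgue \<Omega> - distribution_fun \<Omega> a A)"
      "{x \<in> ball 0 r. A < ?as x} = ball 0 r - cball 0 \<rho>"
      using superlevel_symmetric_increasing_rearrangement [OF \<Omega> lev(1) A0 vol] r by auto
    have empty: "{x \<in> \<Omega>. A < \<bar>a x\<bar>} = {}" using A' by (auto simp: not_less)
    have "distribution_fun \<Omega> a A = 0" unfolding distribution_fun_def empty by simp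
    then have "emeasure lborel (cball (0::real^'n) \<rho>) = emeasure lborel (ball (0::real^'n) r)"
      using \<rho>(2) r vol by (simp add: emeasure_ball)
    then have "\<rho> ^ DIM(real^'n) = r ^ DIM(real^'n)"
      using \<rho>(1) r unit_ball_vol_pos [of "real CARD('n)", THEN less_imp_neq]
      by (simp add: emeasure_ball emeasure_cball)
    from power_eq_imp_eq_base [OF this] have "r \<le> \<rho>" using \<rho>(1) r by simp
    then have "x \<notin> {x \<in> ball 0 r. A < ?as x}" unfolding \<rho>(3) using that by (auto simp: \<Omega>s_ball)
    then show ?thesis using that as0 [of x] by (simp add: \<Omega>s_ball)
  qed
  have asM: "?as \<in> borel_measurable (lebesgue_on \<Omega>s)"
  proof -
    have "b \<in> borel_measurable (lebesgue_on \<Omega>s)"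
      by (intro measurable_restrict_space1 measurable_completion) simp
    then show ?thesis
      by (rule measurable_cong [THEN iffD1, rotated]) (simp add: space_restrict_space b_def)
  qed
  interpret Bs: bounded_nonlocal J \<Omega>s ?as A
    using \<Omega>s_measure \<Omega>_pos J_nonneg J_le J_minus asM as_le by unfold_locales (auto simp: \<Omega>s_ball)

  have g_ind: "indicator \<Omega>s x * g x = g x" for x using g_out [of x] by (auto simp: indicator_def)
  have norms: "(\<integral>\<^sup>+x. ennreal (g x) * ennreal (g x) \<partial>lborel) = ennreal (L2_inner \<Omega> \<phi> \<phi>)"
  proof -
    have "ennreal (L2_inner \<Omega> \<phi> \<phi>) = (\<integral>\<^sup>+x. ennreal (f x) * ennreal (f x) \<partial>lborel)"
      unfolding f_def by (rule B.ennreal_inner_self [OF \<phi> \<phi>_nonneg])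
    then show ?thesis
      using nn_integral_square_rearrangement [OF \<Omega> f_meas f] by (simp add: g_def)
  qed
  have gL2: "g \<in> L2_space \<Omega>s"
  proof -
    have "integrable lborel (\<lambda>x. (g x)\<^sup>2)"
    proof (rule integrableI_nonneg)
      have "(\<integral>\<^sup>+x. ennreal ((g x)\<^sup>2) \<partial>lborel) = ennreal (L2_inner \<Omega> \<phi> \<phi>)"
        unfolding norms [symmetric] using g0 by (simp add: power2_eq_square ennreal_mult)
      then show "(\<integral>\<^sup>+x. ennreal ((g x)\<^sup>2) \<partial>lborel) < \<infinity>" by simp
    qed auto
    then have "integrable lebesgue (\<lambda>x. (g x)\<^sup>2)" by (simp add: integrable_completion)
    moreover have "(\<lambda>x. indicator \<Omega>s x *\<^sub>R (g x)\<^sup>2) = (\<lambda>x. (g x)\<^sup>2)"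
      using g_out by (auto simp: fun_eq_iff indicator_def)
    ultimately have "integrable (lebesgue_on \<Omega>s) (\<lambda>x. (g x)\<^sup>2)"
      by (subst integrable_restrict_space) (simp_all add: \<Omega>s_ball)
    moreover have "g \<in> borel_measurable (lebesgue_on \<Omega>s)"
      by (intro measurable_restrict_space1 measurable_completion) simp
    ultimately show ?thesis by (simp add: L2_space_def)
  qed
  have N: "L2_inner \<Omega>s g g = L2_inner \<Omega> \<phi> \<phi>"
    using Bs.ennreal_inner_self [OF gL2 g0] norms by (simp add: g_ind L2_inner_nonneg)
  have P: "L2_inner \<Omega>s (\<lambda>x. ?as x * g x) g \<le> L2_inner \<Omega> (\<lambda>x. a x * \<phi> x) \<phi>"
  proof -
    have "ennreal (L2_inner \<Omega>s (\<lambda>x. ?as x * g x) g) = (\<integral>\<^sup>+x. ennreal (b x) * ennreal ((g x)\<^sup>2) \<partial>lborel)"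
      using Bs.ennreal_inner_a_mult [OF gL2 g0 as0] by (simp add: g_ind b_def)
    also have "\<dots> \<le> (\<integral>\<^sup>+x. ennreal (indicator \<Omega> x * a x) * ennreal ((f x)\<^sup>2) \<partial>lborel)"
      unfolding g_def b_def \<Omega>s_ball
      by (rule nn_integral_increasing_decreasing_rearrangement_le
        [OF \<Omega> \<Omega>_borel f_meas f a_meas a0 vol less_imp_le [OF r]])
    also have "\<dots> = ennreal (L2_inner \<Omega> (\<lambda>x. a x * \<phi> x) \<phi>)"
      unfolding f_def by (rule B.ennreal_inner_a_mult [OF \<phi> \<phi>_nonneg a0, symmetric])
    finally have "ennreal (L2_inner \<Omega>s (\<lambda>x. ?as x * g x) g) \<le> ennreal (L2_inner \<Omega> (\<lambda>x. a x * \<phi> x) \<phi>)" .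
    \<comment> \<open>\<open>ennreal\<close> truncates at 0, so the inequality carries over to the
      reals only with a nonnegative right-hand side.\<close>
    moreover have "0 \<le> L2_inner \<Omega> (\<lambda>x. a x * \<phi> x) \<phi>"
      unfolding L2_inner_def using a0 \<phi>_nonneg by (intro integral_nonneg_AE AE_I2) (simp add: space_restrict_space)
    ultimately show ?thesis by simp
  qed
  have Q: "L2_inner \<Omega> (B.conv \<phi>) \<phi> \<le> L2_inner \<Omega>s (Bs.conv g) g"
  proof -
    have "ennreal (L2_inner \<Omega> (B.conv \<phi>) \<phi>) =
        (\<integral>\<^sup>+x. \<integral>\<^sup>+y. ennreal (f x) * ennreal (f y) * ennreal (J (x - y)) \<partial>lborel \<partial>lborel)"
      unfolding f_def by (rule B.ennreal_inner_conv [OF \<phi> \<phi>_nonneg f_meas [unfolded f_def [abs_def]]])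
    also have "\<dots> \<le> (\<integral>\<^sup>+x. \<integral>\<^sup>+y. ennreal (g x) * ennreal (g y) * ennreal (J (x - y)) \<partial>lborel \<partial>lborel)"
      unfolding g_def
      by (rule energy_le_energy_rearrangement [OF \<Omega> R f_meas f J_meas J_decreasing])
    also have "\<dots> = ennreal (L2_inner \<Omega>s (Bs.conv g) g)"
      using Bs.ennreal_inner_conv [OF gL2 g0] by (simp add: g_ind)
    finally have "ennreal (L2_inner \<Omega> (B.conv \<phi>) \<phi>) \<le> ennreal (L2_inner \<Omega>s (Bs.conv g) g)" .
    moreover have "0 \<le> L2_inner \<Omega>s (Bs.conv g) g"
      unfolding L2_inner_def using g0 Bs.conv_nonneg [OF g0] by (intro integral_nonneg_AE AE_I2) simp
    ultimately show ?thesis by simp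
  qed
  have eigen: "L2_inner \<Omega> (nonlocal_operator J \<Omega> a \<phi>) \<phi> = lam1 * L2_inner \<Omega> \<phi> \<phi>"
  proof -
    note [measurable] = L2_space_measurable [OF \<phi>] L2_space_measurable [OF B.a_mult_L2 [OF \<phi>]] B.conv_measurable [OF \<phi>]
    have [measurable]: "nonlocal_operator J \<Omega> a \<phi> \<in> borel_measurable (lebesgue_on \<Omega>)"
      unfolding B.nonlocal_operator_eq by measurable
    have "L2_inner \<Omega> (nonlocal_operator J \<Omega> a \<phi>) \<phi> = (LINT x|lebesgue_on \<Omega>. lam1 * (\<phi> x * \<phi> x))"
      unfolding L2_inner_def using \<phi>_eq
      by (intro integral_cong_AE) (auto simp: L2_eq_def elim!: eventually_mono)
    then show ?thesis by (simp add: L2_inner_def)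
  qed
  have N_pos: "0 < L2_inner \<Omega> \<phi> \<phi>"
  proof (rule ccontr)
    assume "\<not> ?thesis"
    then have "L2_inner \<Omega> \<phi> \<phi> = 0" using L2_inner_nonneg [of \<Omega> \<phi>] by simp
    then have "AE x in lebesgue_on \<Omega>. \<phi> x * \<phi> x = 0"
      unfolding L2_inner_def using integral_nonneg_eq_0_iff_AE [OF integrable_mult_L2 [OF \<phi> \<phi>]] by simp
    then show False using \<phi>_neq by (simp add: L2_eq_def)
  qed
  \<comment> \<open>\<open>g\<close> serves as trial function for the second operator; at both ends
    of the chain stands the same squared norm, by \<open>N\<close>, and it is positive and
    cancels.\<close>
  have "lam1s * L2_inner \<Omega>s g g \<le> L2_inner \<Omega>s (nonlocal_operator J \<Omega>s ?as g) g"
    using first_star gL2 by (intro Bs.Rayleigh_nonlocal_operator) (auto simp: first_eigenvalue_def)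
  also have "\<dots> = L2_inner \<Omega>s (\<lambda>x. ?as x * g x) g - L2_inner \<Omega>s (Bs.conv g) g"
    by (rule Bs.inner_nonlocal_operator [OF gL2 gL2])
  also have "\<dots> \<le> L2_inner \<Omega> (\<lambda>x. a x * \<phi> x) \<phi> - L2_inner \<Omega> (B.conv \<phi>) \<phi>"
    using P Q by simp
  also have "\<dots> = lam1 * L2_inner \<Omega> \<phi> \<phi>"
    using B.inner_nonlocal_operator [OF \<phi> \<phi>] eigen by simp
  finally show ?thesis using N_pos by (simp add: N)
qed

end
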